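(* Let $p$ be a prime and $r\in(1,\infty)$. For any $f\in\mathrm{Ces}_r(\mathbb{Q}_p)$, $$\|\mathscr{H}^pf\|_{\mathrm{Ces}_r(\mathbb{Q}_p)}\le\frac{1-p^{-1}}{1-p^{-(1-1/r)}}\,\|f\|_{\mathrm{Ces}_r(\mathbb{Q}_p)},$$ where $\mathscr{H}^p$ is the $p$-adic Hardy operator $$\mathscr{H}^pf(x)=\frac{1}{|x|_p}\int_{|y|_p\le|x|_p}f(y)\,dy,\qquad x\in\mathbb{Q}_p^*.$$
   Context: $\mathbb{Q}_p$ is the field of $p$-adic numbers with absolute value $|\cdot|_p$ normalized by $|p|_p=p^{-1}$, and $\mathbb{Q}_p^*=\mathbb{Q}_p\setminus\{0\}$. $dx$ is the additive Haar measure on $\mathbb{Q}_p$ normalized so that $\{x:|x|_p\le 1\}$ has measure $1$. For $1\le r<\infty$, the $p$-adic Cesàro function space $\mathrm{Ces}_r(\mathbb{Q}_p)$ consists of all measurable functions $f$ on $\mathbb{Q}_p$ with $$\|f\|_{\mathrm{Ces}_r(\mathbb{Q}_p)}=\left(\int_{\mathbb{Q}_p}\left(\frac{1}{|x|_p}\int_{|y|_p\le|x|_p}|f(y)|\,dy\right)^r dx\right)^{1/r}<\infty.$$ *)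

theory Defs
  imports "HOL-Analysis.Analysis" "HOL-Algebra.QuotRing"
begin

section \<open>The field of p-adic numbers\<close>

text \<open>
  The prime is an ordinary variable, so the field depends on a term and cannot be a type of its
  own. It is the usual completion of the rationals, written as a ring in the sense of HOL-Algebra:
  Cauchy sequences for the p-adic absolute value modulo the ideal of null sequences.
\<close>

definition rat_padic_val :: "nat \<Rightarrow> rat \<Rightarrow> int" where
  "rat_padic_val p q =
     int (multiplicity (int p) (fst (quotient_of q)))
   - int (multiplicity (int p) (snd (quotient_of q)))"

definition rat_padic_abs :: "nat \<Rightarrow> rat \<Rightarrow> real" where
  "rat_padic_abs p q = (if q = 0 then 0 else real p powi (- rat_padic_val p q))"

definition padic_Cauchy :: "nat \<Rightarrow> (nat \<Rightarrow> rat) \<Rightarrow> bool" where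
  "padic_Cauchy p X \<longleftrightarrow>
     (\<forall>e>0. \<exists>N. \<forall>m\<ge>N. \<forall>n\<ge>N. rat_padic_abs p (X m - X n) < e)"

definition padic_Cauchy_ring :: "nat \<Rightarrow> (nat \<Rightarrow> rat) ring" where
  "padic_Cauchy_ring p =
     \<lparr>carrier = {X. padic_Cauchy p X},
      mult = (\<lambda>X Y n. X n * Y n), one = (\<lambda>n. 1),
      zero = (\<lambda>n. 0), add = (\<lambda>X Y n. X n + Y n)\<rparr>"

definition padic_null :: "nat \<Rightarrow> (nat \<Rightarrow> rat) set" where
  "padic_null p = {X. (\<lambda>n. rat_padic_abs p (X n)) \<longlonglongrightarrow> 0}"

definition Qp :: "nat \<Rightarrow> (nat \<Rightarrow> rat) set ring" where
  "Qp p = padic_Cauchy_ring p Quot padic_null p"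

text \<open>
  Elements of \<open>Qp p\<close> are cosets of Cauchy sequences; all members of a coset have
  absolute values converging to the same limit.
\<close>

definition Qp_abs :: "nat \<Rightarrow> (nat \<Rightarrow> rat) set \<Rightarrow> real" where
  "Qp_abs p x = (THE c. \<forall>X\<in>x. (\<lambda>n. rat_padic_abs p (X n)) \<longlonglongrightarrow> c)"

definition Qp_dist :: "nat \<Rightarrow> (nat \<Rightarrow> rat) set \<Rightarrow> (nat \<Rightarrow> rat) set \<Rightarrow> real" where
  "Qp_dist p x y = Qp_abs p (x \<ominus>\<^bsub>Qp p\<^esub> y)"

definition Qp_ball :: "nat \<Rightarrow> real \<Rightarrow> (nat \<Rightarrow> rat) set set" where
  "Qp_ball p c = {y \<in> carrier (Qp p). Qp_abs p y \<le> c}"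


section \<open>Haar measure\<close>

definition Qp_borel :: "nat \<Rightarrow> (nat \<Rightarrow> rat) set measure" where
  "Qp_borel p =
     sigma (carrier (Qp p)) {U. openin (Metric_space.mtopology (carrier (Qp p)) (Qp_dist p)) U}"

text \<open>
  These conditions determine the measure: finiteness on compact sets and regularity follow from
  translation invariance and the normalization, because \<open>Qp p\<close> is a countable disjoint union of
  translates of the compact open unit ball. The Borel measure is completed, so that ``measurable''
  below means Haar measurable.
\<close>

definition Qp_Haar :: "nat \<Rightarrow> (nat \<Rightarrow> rat) set measure \<Rightarrow> bool" where
  "Qp_Haar p M \<longleftrightarrow>
     (\<exists>N. sets N = sets (Qp_borel p) \<and>
          (\<forall>a\<in>carrier (Qp p). \<forall>A\<in>sets N.
              emeasure N ((\<lambda>x. a \<oplus>\<^bsub>Qp p\<^esub> x) ` A) = emeasure N A) \<and>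
          emeasure N (Qp_ball p 1) = 1 \<and>
          M = completion N)"


section \<open>Cesaro function spaces and the Hardy operator\<close>

text \<open>Real power on \<open>[0, \<infinity>]\<close>, only used with a positive exponent.\<close>

definition ennreal_powr :: "ennreal \<Rightarrow> real \<Rightarrow> ennreal" where
  "ennreal_powr t a = (if t = \<infinity> then \<infinity> else ennreal (enn2real t powr a))"

text \<open>
  In the next two definitions \<open>1 / Qp_abs p x\<close> is \<open>0\<close> at the point \<open>x = 0\<close>, which is a null set.
\<close>

definition Ces_norm ::
  "nat \<Rightarrow> (nat \<Rightarrow> rat) set measure \<Rightarrow> real \<Rightarrow> ((nat \<Rightarrow> rat) set \<Rightarrow> complex) \<Rightarrow> ennreal" where
  "Ces_norm p M r f =
     ennreal_powr
       (\<integral>\<^sup>+x. ennreal_powr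
          (ennreal (1 / Qp_abs p x) *
             (\<integral>\<^sup>+y\<in>Qp_ball p (Qp_abs p x). ennreal (norm (f y)) \<partial>M)) r \<partial>M)
       (1 / r)"

definition Ces ::
  "nat \<Rightarrow> (nat \<Rightarrow> rat) set measure \<Rightarrow> real \<Rightarrow> ((nat \<Rightarrow> rat) set \<Rightarrow> complex) set" where
  "Ces p M r = {f \<in> borel_measurable M. Ces_norm p M r f < \<infinity>}"

text \<open>
  A function in a Cesaro space is integrable on every ball, so the Bochner integral below does not
  take its default value there.
\<close>

definition padic_Hardy ::
  "nat \<Rightarrow> (nat \<Rightarrow> rat) set measure \<Rightarrow> ((nat \<Rightarrow> rat) set \<Rightarrow> complex) \<Rightarrow> (nat \<Rightarrow> rat) set \<Rightarrow> complex"
  where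
  "padic_Hardy p M f x =
     complex_of_real (1 / Qp_abs p x) * (LINT y:Qp_ball p (Qp_abs p x)|M. f y)"

end

theory Submission
  imports Defs
begin

text \<open>
  The Cesaro norm of \<open>f\<close> is the \<open>L\<^sup>r\<close> norm of \<open>\<Phi>\<close>, where \<open>\<Phi> x\<close> is the average of \<open>\<bar>f\<bar>\<close> over the ball
  of radius \<open>\<bar>x\<bar>\<close>. Since \<open>\<Phi>\<close> dominates the Hardy operator applied to \<open>f\<close>, the Cesaro norm of the
  latter is at most the \<open>L\<^sup>r\<close> norm of the averages of \<open>\<Phi>\<close>. So the theorem is Hardy's inequality in
  \<open>L\<^sup>r\<close> for \<open>\<Phi>\<close>. Balls have measure \<open>p powi k\<close>, and averaging a radial function over balls is a
  superposition of dilations: the sphere whose radius is that of the ball divided by \<open>p powi i\<close> has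
  the fraction \<open>(1 - 1 / p) * p powi (- i)\<close> of the measure of the ball, and the corresponding
  dilation multiplies the norm by \<open>p powr (i / r)\<close>. The constant is the sum of the geometric series
  with these products as terms.

  The formal proof keeps this computation (\<open>discrete_Hardy\<close>), but carries it out for decreasing
  rearrangements on the half-line (\<open>Hardy_distribution\<close>). The reason is that the only information
  used about the Haar measure is \<open>emeasure_Haar_le\<close>: a measurable subset of the ball of radius
  \<open>p powi k\<close> has measure at most \<open>p powi k\<close>. This follows from translation invariance and the
  measure of the unit ball. Integrals over balls are then treated as lower integrals. The average
  of \<open>\<Phi>\<close> over the ball of radius \<open>p powi k\<close> is at most the average of the rearrangement of a
  measurable function \<open>\<psi> \<le> \<Phi>\<close> over the interval from \<open>0\<close> to \<open>p powi k\<close>. These latter averages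
  decrease with \<open>k\<close>, so only upper bounds for the measure of balls are needed to integrate them.
  This is \<open>Hardy_nn_integral\<close>.
\<close>

(* The name top refers to the greatest element of a lattice, here infinity in ennreal,
   and not to the constant of the same name for orders with explicit carriers. *)
hide_const (open) Order.top

section \<open>Real powers of extended nonnegative reals\<close>

lemma ennreal_powr_top [simp]: "ennreal_powr top a = top"
  by (simp add: ennreal_powr_def)

lemma ennreal_powr_ennreal [simp]: "0 \<le> x \<Longrightarrow> ennreal_powr (ennreal x) a = ennreal (x powr a)"
  by (simp add: ennreal_powr_def)

lemma ennreal_powr_zero [simp]: "ennreal_powr 0 a = 0"
  by (simp add: ennreal_powr_def)

lemma ennreal_powr_one [simp]: "ennreal_powr t 1 = t"
  by (cases t) auto

lemma ennreal_powr_mono: "x \<le> y \<Longrightarrow> 0 \<le> a \<Longrightarrow> ennreal_powr x a \<le> ennreal_powr y a"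
  by (cases x; cases y) (auto intro: powr_mono2 ennreal_leI simp: top_unique)

lemma ennreal_powr_cmult:
  "0 < c \<Longrightarrow> ennreal_powr (ennreal c * t) a = ennreal (c powr a) * ennreal_powr t a"
  by (cases t) (auto simp: powr_mult ennreal_mult ennreal_mult_top simp flip: ennreal_mult)

lemma borel_measurable_ennreal_powr [measurable]: "(\<lambda>t. ennreal_powr t a) \<in> borel_measurable borel"
  unfolding ennreal_powr_def by measurable

text \<open>
  The right-hand side minus the left-hand side is the distance of the convex function \<open>t powr r\<close>
  from its tangent at \<open>a\<close>. Written without subtraction of multiples of \<open>t\<close>, the inequality passes to
  infinite \<open>t\<close>. It takes the place of Hoelder's inequality in the estimates below.
\<close>

lemma Young_powr:
  fixes r a t :: real
  assumes "1 < r" "0 \<le> a" "0 \<le> t"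
  shows "r * a powr (r - 1) * t \<le> t powr r + (r - 1) * a powr r"
proof (cases "a = 0 \<or> t = 0")
  case True
  then show ?thesis using assms by auto
next
  case False
  then have pos: "a > 0" "t > 0" using assms by auto
  have "1 + r * (t / a - 1) \<le> (1 + (t / a - 1)) powr r"
  proof -
    have "((\<lambda>x. x powr r) has_real_derivative r) (at 1 within {0<..})"
      by (rule has_field_derivative_at_within) (auto intro!: derivative_eq_intros)
    moreover have cv: "convex_on {0<..} (\<lambda>x::real. x powr r)"
      using assms by (intro convex_on_subset[OF powr_convex]) auto
    ultimately show ?thesis
      using convex_on_imp_above_tangent[OF cv, of 1 "t / a" r] pos
      by (auto simp: interior_open)
  qed
  then have "1 + r * (t / a - 1) \<le> (t / a) powr r" by simp
  then have "a powr r * (1 + r * (t / a - 1)) \<le> a powr r * (t / a) powr r"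
    by (intro mult_left_mono) auto
  also have "\<dots> = t powr r"
    using pos by (simp add: powr_divide)
  finally have "a powr r * (1 + r * (t / a - 1)) \<le> t powr r" .
  moreover have "a powr r * (1 + r * (t / a - 1)) = r * a powr (r - 1) * t - (r - 1) * a powr r"
    using pos by (simp add: powr_diff field_simps)
  ultimately show ?thesis by simp
qed

lemma Young_ennreal:
  assumes "1 < r" "0 \<le> a"
  shows "ennreal (r * a powr (r - 1)) * t \<le> ennreal_powr t r + ennreal ((r - 1) * a powr r)"
proof (cases t)
  case (real x)
  then show ?thesis
    using Young_powr[OF assms, of x] assms
    by (simp flip: ennreal_plus ennreal_mult)
qed simp

text \<open>
  The tangent at the mean value \<open>a = I / W\<close> of \<open>v\<close> is integrated against \<open>w\<close>. That needs the mean
  value to be finite, which the tangent at \<open>1\<close> gives whenever the right-hand side is finite.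
\<close>

lemma Jensen_powr_nn_integral:
  fixes w v :: "'a \<Rightarrow> ennreal"
  assumes [measurable]: "w \<in> borel_measurable M" "v \<in> borel_measurable M"
    and W: "(\<integral>\<^sup>+x. w x \<partial>M) = ennreal W" "0 < W" and r: "1 < r"
  shows "ennreal_powr (\<integral>\<^sup>+x. w x * v x \<partial>M) r
           \<le> ennreal (W powr (r - 1)) * (\<integral>\<^sup>+x. w x * ennreal_powr (v x) r \<partial>M)"
    (is "ennreal_powr ?I r \<le> _ * ?J")
proof -
  have key: "ennreal (r * a powr (r - 1)) * ?I \<le> ?J + ennreal ((r - 1) * a powr r * W)"
    if "0 \<le> a" for a
  proof -
    have "ennreal (r * a powr (r - 1)) * ?I = (\<integral>\<^sup>+x. w x * (ennreal (r * a powr (r - 1)) * v x) \<partial>M)"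
      by (simp add: nn_integral_cmult mult.left_commute[of "w _"])
    also have "\<dots> \<le> (\<integral>\<^sup>+x. w x * (ennreal_powr (v x) r + ennreal ((r - 1) * a powr r)) \<partial>M)"
      by (intro nn_integral_mono mult_left_mono Young_ennreal r that) auto
    also have "\<dots> = ?J + (\<integral>\<^sup>+x. w x \<partial>M) * ennreal ((r - 1) * a powr r)"
      by (simp add: distrib_left nn_integral_add nn_integral_multc)
    also have "\<dots> = ?J + ennreal ((r - 1) * a powr r * W)"
      using r W by (simp add: ennreal_mult mult.commute)
    finally show ?thesis .
  qed
  show ?thesis
  proof (cases "?J = top")
    case True
    then show ?thesis using W by (simp add: ennreal_mult_top)
  next
    case False
    then obtain J where J: "?J = ennreal J" "0 \<le> J" by (cases ?J) auto
    have "ennreal r * ?I < top"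
      using key[of 1] J r W by (auto simp: le_less_trans less_top simp flip: ennreal_plus)
    then have "?I \<noteq> top"
      using r by (auto simp: ennreal_mult_top)
    then obtain I where I: "?I = ennreal I" "0 \<le> I" by (cases ?I) auto
    have "r * ((I / W) powr (r - 1) * I) \<le> J + (r - 1) * (I / W) powr r * W"
      using key[of "I / W"] I J W r by (simp flip: ennreal_plus ennreal_mult add: mult.assoc)
    moreover have "(I / W) powr (r - 1) * I = (I / W) powr r * W"
      using I W by (cases "I = 0") (auto simp: powr_diff field_simps)
    ultimately have "r * ((I / W) powr r * W) \<le> J + (r - 1) * (I / W) powr r * W"
      by simp
    then have "(I / W) powr r * W \<le> J"
      by (simp add: left_diff_distrib mult.assoc)
    then have "I powr r \<le> W powr (r - 1) * J"
      using I W by (simp add: powr_divide powr_diff field_simps)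
    then show ?thesis
      using I J by (simp flip: ennreal_mult)
  qed
qed

section \<open>A discrete Hardy inequality\<close>

lemma nn_integral_atMost_int:
  fixes f :: "int \<Rightarrow> ennreal"
  shows "(\<integral>\<^sup>+j. f j * indicator {..k} j \<partial>count_space UNIV) = (\<Sum>i. f (k - int i))"
proof -
  have "bij_betw (\<lambda>i. k - int i) UNIV {..k}"
    by (rule bij_betw_byWitness[where f' = "\<lambda>j. nat (k - j)"]) auto
  then have "(\<integral>\<^sup>+i. f (k - int i) \<partial>count_space UNIV) = (\<integral>\<^sup>+j. f j \<partial>count_space {..k})"
    by (rule nn_integral_bij_count_space)
  then show ?thesis
    by (simp add: nn_integral_count_space_nat nn_integral_count_space_indicator)
qed

lemma nn_integral_shift_int:
  fixes f :: "int \<Rightarrow> ennreal"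
  shows "(\<integral>\<^sup>+k. f (k - i) \<partial>count_space UNIV) = (\<integral>\<^sup>+k. f k \<partial>count_space UNIV)"
  by (rule nn_integral_bij_count_space)
     (rule bij_betw_byWitness[where f' = "\<lambda>j. j + i"], auto)

lemma geometric_powr_sums:
  assumes "1 < q" "0 < a"
  shows "(\<lambda>i. q powr (- a * real i)) sums (1 / (1 - q powr (- a)))"
proof -
  have "q powr (- a) < 1"
    using assms by (simp add: powr_less_one)
  then have "(\<lambda>i. (q powr (- a)) ^ i) sums (1 / (1 - q powr (- a)))"
    by (intro geometric_sums) auto
  then show ?thesis
    using assms by (simp add: powr_powr powr_realpow[symmetric])
qed

text \<open>
  The inner sum is a superposition of shifts of \<open>F\<close>, and the shift by \<open>i\<close> multiplies the norm of
  \<open>F\<close> in the weighted space by \<open>q powr (i / r)\<close>; so the constant is the sum of the geometric series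
  with terms \<open>q powr (- i) * q powr (i / r)\<close>. Minkowski's inequality is obtained from Jensen's
  inequality for the weights \<open>w i\<close>, the terms of that series: after the split
  \<open>q powr (- i) = w i * q powr (- i / r)\<close> the remaining factor just compensates the growth of the
  norm under the shift, and no constant is lost.
\<close>

lemma discrete_Hardy:
  fixes F :: "int \<Rightarrow> ennreal"
  assumes q: "1 < q" and r: "1 < r"
  defines "W \<equiv> 1 / (1 - q powr (- (1 - 1 / r)))"
  shows "(\<integral>\<^sup>+k. ennreal (q powr k) * ennreal_powr (\<Sum>i. ennreal (q powr (- real i)) * F (k - int i)) r
             \<partial>count_space UNIV)
           \<le> ennreal (W powr r) * (\<integral>\<^sup>+k. ennreal (q powr k) * ennreal_powr (F k) r \<partial>count_space UNIV)"
proof -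
  define b where "b = 1 - 1 / r"
  have b: "0 < b" using r by (simp add: b_def)
  define w where "w i = ennreal (q powr (- b * real i))" for i :: nat
  have sums: "(\<lambda>i. q powr (- b * real i)) sums W"
    using geometric_powr_sums[OF q b] by (simp add: W_def b_def)
  have Wpos: "0 < W"
    using q b by (simp add: W_def b_def[symmetric] powr_less_one)
  have sumw: "(\<Sum>i. w i) = ennreal W"
    unfolding w_def by (rule suminf_ennreal_eq[OF _ sums]) simp
  have Jensen: "ennreal_powr (\<Sum>i. ennreal (q powr (- real i)) * F (k - int i)) r
       \<le> ennreal (W powr (r - 1)) *
         (\<Sum>i. w i * (ennreal (q powr (- real i)) * ennreal_powr (F (k - int i)) r))" for k
  proof -
    define v where "v i = ennreal (q powr (- real i / r)) * F (k - int i)" for i :: nat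
    have "w i * v i = ennreal (q powr (- real i)) * F (k - int i)" for i
    proof -
      have "- b * real i + - real i / r = - real i"
        by (simp add: b_def left_diff_distrib)
      then have "q powr (- b * real i) * q powr (- real i / r) = q powr (- real i)"
        by (metis powr_add)
      then show ?thesis
        by (simp add: w_def v_def mult.assoc[symmetric] ennreal_mult[symmetric])
    qed
    moreover have "ennreal_powr (v i) r = ennreal (q powr (- real i)) * ennreal_powr (F (k - int i)) r" for i
      using q r by (simp add: v_def ennreal_powr_cmult powr_powr)
    ultimately show ?thesis
      using Jensen_powr_nn_integral[of w "count_space UNIV" v W r] sumw Wpos r
      by (simp add: nn_integral_count_space_nat)
  qed
  define S where "S = (\<integral>\<^sup>+k. ennreal (q powr k) * ennreal_powr (F k) r \<partial>count_space (UNIV :: int set))"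
  have "(\<integral>\<^sup>+k. ennreal (q powr k) * ennreal_powr (\<Sum>i. ennreal (q powr (- real i)) * F (k - int i)) r
             \<partial>count_space UNIV)
        \<le> (\<integral>\<^sup>+k. ennreal (q powr k) * (ennreal (W powr (r - 1)) *
             (\<Sum>i. w i * (ennreal (q powr (- real i)) * ennreal_powr (F (k - int i)) r)))
             \<partial>count_space UNIV)"
    by (intro nn_integral_mono mult_left_mono Jensen) auto
  also have "\<dots> = (\<integral>\<^sup>+k. ennreal (W powr (r - 1)) * (\<Sum>i. w i *
               (ennreal (q powr (k - int i)) * ennreal_powr (F (k - int i)) r)) \<partial>count_space UNIV)"
  proof (intro nn_integral_cong)
    fix k :: int
    have qk: "ennreal (q powr k) * (w i * (ennreal (q powr (- real i)) * t))
            = w i * (ennreal (q powr (k - int i)) * t)" for i t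
    proof -
      have "q powr (k - int i) = q powr k * q powr (- real i)"
        by (simp flip: powr_add)
      then show ?thesis
        by (simp add: ennreal_mult mult_ac)
    qed
    have "ennreal (q powr k) * (ennreal (W powr (r - 1)) *
             (\<Sum>i. w i * (ennreal (q powr (- real i)) * ennreal_powr (F (k - int i)) r)))
        = ennreal (W powr (r - 1)) *
             (\<Sum>i. ennreal (q powr k) * (w i * (ennreal (q powr (- real i)) * ennreal_powr (F (k - int i)) r)))"
      by (subst ennreal_suminf_cmult) (rule mult.left_commute)
    then show "ennreal (q powr k) * (ennreal (W powr (r - 1)) *
             (\<Sum>i. w i * (ennreal (q powr (- real i)) * ennreal_powr (F (k - int i)) r)))
          = ennreal (W powr (r - 1)) * (\<Sum>i. w i *
               (ennreal (q powr (k - int i)) * ennreal_powr (F (k - int i)) r))"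
      by (simp only: qk)
  qed
  also have "\<dots> = ennreal (W powr (r - 1)) * (\<Sum>i. w i * S)"
  proof -
    have "(\<integral>\<^sup>+k. ennreal (q powr (k - int i)) * ennreal_powr (F (k - int i)) r \<partial>count_space UNIV) = S" for i
      unfolding S_def by (rule nn_integral_shift_int[of "\<lambda>k. ennreal (q powr k) * ennreal_powr (F k) r"])
    then show ?thesis
      by (subst nn_integral_cmult, simp, subst nn_integral_suminf, simp, subst nn_integral_cmult, simp)
         (simp only:)
  qed
  also have "\<dots> = ennreal (W powr r) * S"
    using Wpos by (simp add: sumw powr_diff mult.assoc[symmetric] ennreal_mult[symmetric])
  finally show ?thesis by (simp add: S_def)
qed

section \<open>Layer cake representation\<close>

abbreviation half_line :: "real measure" where
  "half_line \<equiv> restrict_space lborel {0<..}"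

lemma sigma_finite_half_line: "sigma_finite_measure half_line"
  by (rule sigma_finite_measure_restrict_space) (auto intro: lborel.sigma_finite_measure_axioms)

lemma measurable_half_line: "f \<in> measurable borel N \<Longrightarrow> f \<in> measurable half_line N"
  by (intro measurable_restrict_space1) simp

lemma nn_integral_powr_half_line:
  assumes r: "1 \<le> r"
  shows "(\<integral>\<^sup>+s. ennreal (r * s powr (r - 1)) * indicator {s. ennreal s < y} s \<partial>half_line) = ennreal_powr y r"
    (is "?I y = _")
proof -
  have fin: "?I (ennreal x) = ennreal (x powr r)" if "0 \<le> x" for x
  proof -
    have "((\<lambda>s. r * s powr (r - 1)) has_integral (r * (x powr (r - 1 + 1) / (r - 1 + 1)))) {0..x}"
      using r that by (intro has_integral_mult_right has_integral_powr_from_0) auto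
    then have "((\<lambda>s. r * s powr (r - 1)) has_integral x powr r) {0..x}"
      using r by simp
    then have "(\<integral>\<^sup>+s. ennreal (r * s powr (r - 1)) * indicator {0..x} s \<partial>lborel) = ennreal (x powr r)"
      using r by (intro nn_integral_has_integral_lebesgue') auto
    moreover have "?I (ennreal x) = (\<integral>\<^sup>+s. ennreal (r * s powr (r - 1)) * indicator {s. ennreal s < ennreal x} s * indicator {0<..} s \<partial>lborel)"
      by (simp add: nn_integral_restrict_space)
    moreover have "\<dots> = (\<integral>\<^sup>+s. ennreal (r * s powr (r - 1)) * indicator {0..x} s \<partial>lborel)"
    proof (rule nn_integral_cong_AE)
      have "AE s in lborel. s \<noteq> 0" "AE s in lborel. s \<noteq> x"
        by (rule AE_lborel_singleton)+
      then show "AE s in lborel. ennreal (r * s powr (r - 1)) * indicator {s. ennreal s < ennreal x} s * indicator {0<..} s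
          = ennreal (r * s powr (r - 1)) * indicator {0..x} s"
        by eventually_elim (auto simp: indicator_def ennreal_less_iff)
    qed
    ultimately show ?thesis by simp
  qed
  show ?thesis
  proof (cases y)
    case (real x)
    then show ?thesis using fin by simp
  next
    case top
    have "of_nat n \<le> ?I top" for n :: nat
    proof -
      have "of_nat n \<le> ennreal (real n powr r)"
      proof (cases "n = 0")
        case False
        then have "real n powr 1 \<le> real n powr r" using r by (intro powr_mono) auto
        then show ?thesis using False by (simp add: ennreal_of_nat_eq_real_of_nat ennreal_leI)
      qed simp
      also have "\<dots> = ?I (ennreal (real n))" using fin[of "real n"] by simp
      also have "\<dots> \<le> ?I top"
        by (intro nn_integral_mono mult_left_mono) (auto simp: indicator_def)
      finally show ?thesis .
    qed
    then have "?I top = top"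
      using ennreal_Ex_less_of_nat[of "?I top"] leD less_top by blast
    then show ?thesis using top by simp
  qed
qed

lemma subgraph_sets:
  assumes [measurable]: "f \<in> borel_measurable M"
  shows "{z \<in> space (half_line \<Otimes>\<^sub>M M). ennreal (fst z) < f (snd z)} \<in> sets (half_line \<Otimes>\<^sub>M M)"
proof -
  have [measurable]: "(\<lambda>s. s) \<in> borel_measurable half_line"
    by (rule measurable_half_line) simp
  have [measurable]: "fst \<in> borel_measurable (half_line \<Otimes>\<^sub>M M)"
    by (rule measurable_compose[OF measurable_fst]) simp
  show ?thesis by measurable
qed

lemma borel_measurable_distribution:
  assumes "sigma_finite_measure M" and [measurable]: "f \<in> borel_measurable M"
  shows "(\<lambda>s. emeasure M {x \<in> space M. ennreal s < f x}) \<in> borel_measurable half_line"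
proof -
  interpret M: sigma_finite_measure M by fact
  define A where "A = {z \<in> space (half_line \<Otimes>\<^sub>M M). ennreal (fst z) < f (snd z)}"
  have "A \<in> sets (half_line \<Otimes>\<^sub>M M)"
    unfolding A_def by (rule subgraph_sets) fact
  then have "(\<lambda>s. emeasure M (Pair s -` A)) \<in> borel_measurable half_line"
    by (rule M.measurable_emeasure_Pair)
  moreover have "Pair s -` A = {x \<in> space M. ennreal s < f x}" if "s \<in> space half_line" for s
    using that by (auto simp: A_def space_pair_measure)
  ultimately show ?thesis
    by (subst measurable_cong) auto
qed

text \<open>
  Fubini's theorem on the region below the graph of \<open>f\<close>.
\<close>

lemma layer_cake_powr:
  assumes "sigma_finite_measure M" and [measurable]: "f \<in> borel_measurable M" and r: "1 \<le> r"
  shows "(\<integral>\<^sup>+x. ennreal_powr (f x) r \<partial>M)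
           = (\<integral>\<^sup>+s. ennreal (r * s powr (r - 1)) * emeasure M {x \<in> space M. ennreal s < f x} \<partial>half_line)"
proof -
  interpret M: sigma_finite_measure M by fact
  interpret L: sigma_finite_measure half_line by (rule sigma_finite_half_line)
  interpret P: pair_sigma_finite half_line M ..
  have [measurable]: "(\<lambda>s. s) \<in> borel_measurable half_line"
    by (rule measurable_half_line) simp
  have [measurable]: "fst \<in> borel_measurable (half_line \<Otimes>\<^sub>M M)"
    by (rule measurable_compose[OF measurable_fst]) simp
  define A where "A = {z \<in> space (half_line \<Otimes>\<^sub>M M). ennreal (fst z) < f (snd z)}"
  have [measurable]: "A \<in> sets (half_line \<Otimes>\<^sub>M M)"
    unfolding A_def by (rule subgraph_sets) fact
  have meas: "(\<lambda>(s, x). ennreal (r * s powr (r - 1)) * indicator A (s, x)) \<in> borel_measurable (half_line \<Otimes>\<^sub>M M)"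
    unfolding split_beta' prod.collapse by measurable
  have "(\<integral>\<^sup>+x. ennreal_powr (f x) r \<partial>M)
      = (\<integral>\<^sup>+x. \<integral>\<^sup>+s. ennreal (r * s powr (r - 1)) * indicator {s. ennreal s < f x} s \<partial>half_line \<partial>M)"
    by (simp only: nn_integral_powr_half_line[OF r])
  also have "\<dots> = (\<integral>\<^sup>+x. \<integral>\<^sup>+s. ennreal (r * s powr (r - 1)) * indicator A (s, x) \<partial>half_line \<partial>M)"
    by (intro nn_integral_cong) (auto simp: indicator_def space_pair_measure A_def)
  also have "\<dots> = (\<integral>\<^sup>+s. \<integral>\<^sup>+x. ennreal (r * s powr (r - 1)) * indicator A (s, x) \<partial>M \<partial>half_line)"
    by (rule P.Fubini'[OF meas])
  also have "\<dots> = (\<integral>\<^sup>+s. ennreal (r * s powr (r - 1)) * emeasure M {x \<in> space M. ennreal s < f x} \<partial>half_line)"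
  proof (intro nn_integral_cong)
    fix s assume s: "s \<in> space half_line"
    have "(\<integral>\<^sup>+x. ennreal (r * s powr (r - 1)) * indicator A (s, x) \<partial>M)
      = (\<integral>\<^sup>+x. ennreal (r * s powr (r - 1)) * indicator {x \<in> space M. ennreal s < f x} x \<partial>M)"
      using s by (intro nn_integral_cong) (auto simp: indicator_def space_pair_measure A_def)
    then show "(\<integral>\<^sup>+x. ennreal (r * s powr (r - 1)) * indicator A (s, x) \<partial>M)
      = ennreal (r * s powr (r - 1)) * emeasure M {x \<in> space M. ennreal s < f x}"
      by (simp add: nn_integral_cmult_indicator)
  qed
  finally show ?thesis .
qed

lemma nn_integral_half_line_indicator:
  "(\<integral>\<^sup>+s. indicator {s. ennreal s < y} s \<partial>half_line) = y"
proof -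
  have "(\<integral>\<^sup>+s. indicator {s. ennreal s < y} s \<partial>half_line)
      = (\<integral>\<^sup>+s. ennreal (1 * s powr (1 - 1)) * indicator {s. ennreal s < y} s \<partial>half_line)"
    by (intro nn_integral_cong) (auto simp: space_restrict_space)
  then show ?thesis
    using nn_integral_powr_half_line[of 1 y] by simp
qed

lemma layer_cake:
  assumes "sigma_finite_measure M" "f \<in> borel_measurable M"
  shows "(\<integral>\<^sup>+x. f x \<partial>M) = (\<integral>\<^sup>+s. emeasure M {x \<in> space M. ennreal s < f x} \<partial>half_line)"
proof -
  have "(\<integral>\<^sup>+x. f x \<partial>M) = (\<integral>\<^sup>+s. ennreal (1 * s powr (1 - 1)) * emeasure M {x \<in> space M. ennreal s < f x} \<partial>half_line)"
    using layer_cake_powr[OF assms, of 1] by simp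
  also have "\<dots> = (\<integral>\<^sup>+s. emeasure M {x \<in> space M. ennreal s < f x} \<partial>half_line)"
    by (intro nn_integral_cong) (auto simp: space_restrict_space)
  finally show ?thesis .
qed

text \<open>
  Among all functions on the half-line that are bounded by \<open>w\<close> and have a given integral, the
  increasing weight \<open>r * s powr (r - 1)\<close> gives the smallest integral to the one with its mass as
  far left as possible, \<open>w\<close> times the indicator of an interval starting at \<open>0\<close>, whose length \<open>a\<close>
  is the integral divided by \<open>w\<close>; there the weighted integral is \<open>w * a powr r\<close>. The proof compares
  the two functions pointwise for every finite \<open>a\<close>, with the products that the comparison would
  subtract moved to the other side.
\<close>

lemma bathtub_powr:
  assumes [measurable]: "c \<in> borel_measurable half_line" and le: "\<And>s. c s \<le> ennreal w"
    and w: "0 < w" and r: "1 < r"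
  shows "ennreal w * ennreal_powr ((\<integral>\<^sup>+s. c s \<partial>half_line) / ennreal w) r
           \<le> (\<integral>\<^sup>+s. ennreal (r * s powr (r - 1)) * c s \<partial>half_line)"
    (is "_ * ennreal_powr (?I / _) r \<le> ?R")
proof -
  have key: "ennreal (r * a powr (r - 1)) * ?I + ennreal (w * a powr r) \<le> ?R + ennreal (r * w * a powr r)"
    if a: "0 \<le> a" for a
  proof -
    let ?i = "\<lambda>s. indicator {s. ennreal s < ennreal a} s :: ennreal"
    have [measurable]: "(\<lambda>s. ennreal (r * s powr (r - 1))) \<in> borel_measurable half_line"
      by (rule measurable_half_line) measurable
    have [measurable]: "?i \<in> borel_measurable half_line"
      by (rule measurable_half_line) measurable
    have "ennreal (r * a powr (r - 1)) * ?I + ennreal (w * a powr r)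
      = ennreal (r * a powr (r - 1)) * ?I + ennreal w * (\<integral>\<^sup>+s. ennreal (r * s powr (r - 1)) * ?i s \<partial>half_line)"
      using r w a by (subst nn_integral_powr_half_line) (simp_all add: ennreal_mult)
    also have "\<dots> = (\<integral>\<^sup>+s. ennreal (r * a powr (r - 1)) * c s + ennreal w * (ennreal (r * s powr (r - 1)) * ?i s) \<partial>half_line)"
      by (simp add: nn_integral_add nn_integral_cmult)
    also have "\<dots> \<le> (\<integral>\<^sup>+s. ennreal (r * s powr (r - 1)) * c s + ennreal (w * (r * a powr (r - 1))) * ?i s \<partial>half_line)"
    proof (intro nn_integral_mono)
      fix s assume "s \<in> space half_line"
      then have s: "0 < s" by (simp add: space_restrict_space)
      obtain d where d: "c s = ennreal d" "0 \<le> d" "d \<le> w"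
        using le[of s] w by (cases "c s") (auto simp: top_unique)
      define A S where "A = r * a powr (r - 1)" and "S = r * s powr (r - 1)"
      have AS: "0 \<le> A" "0 \<le> S" using r by (auto simp: A_def S_def)
      show "ennreal (r * a powr (r - 1)) * c s + ennreal w * (ennreal (r * s powr (r - 1)) * ?i s)
          \<le> ennreal (r * s powr (r - 1)) * c s + ennreal (w * (r * a powr (r - 1))) * ?i s"
      proof (cases "s < a")
        case True
        then have "S \<le> A" using s r by (auto simp: A_def S_def intro!: powr_mono2)
        then have "0 \<le> (A - S) * (w - d)" using d by simp
        then have "A * d + w * S \<le> S * d + w * A" by (simp add: algebra_simps)
        then show ?thesis
          using True s d AS w unfolding A_def[symmetric] S_def[symmetric]
          by (simp add: ennreal_less_iff flip: ennreal_mult ennreal_plus)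
      next
        case False
        then have "A \<le> S" using a r by (auto simp: A_def S_def intro!: powr_mono2)
        then show ?thesis
          using False s d AS a unfolding A_def[symmetric] S_def[symmetric]
          by (auto simp: ennreal_less_iff intro!: mult_right_mono ennreal_leI)
      qed
    qed
    also have "\<dots> = ?R + ennreal (w * (r * a powr (r - 1))) * ennreal a"
      by (simp add: nn_integral_add nn_integral_cmult nn_integral_half_line_indicator)
    also have "ennreal (w * (r * a powr (r - 1))) * ennreal a = ennreal (r * w * a powr r)"
      using a r w by (cases "a = 0") (auto simp: powr_diff simp flip: ennreal_mult)
    finally show ?thesis .
  qed
  show ?thesis
  proof (cases "?I")
    case (real I)
    define X Y where "X = ennreal (r * w * (I / w) powr r)" and "Y = ennreal (w * (I / w) powr r)"
    have eq: "r * (I / w) powr (r - 1) * I = r * w * (I / w) powr r"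
      using real w by (cases "I = 0") (auto simp: powr_diff)
    have "ennreal (r * (I / w) powr (r - 1)) * ?I = X"
      unfolding real X_def eq[symmetric] using real r by (intro ennreal_mult[symmetric]) auto
    then have "X + Y \<le> ?R + X"
      using key[of "I / w"] real w by (simp only: X_def Y_def) auto
    then have "X + Y \<le> X + ?R" by (simp only: add.commute)
    moreover have "X \<noteq> top" by (simp add: X_def)
    ultimately have "ennreal (w * (I / w) powr r) \<le> ?R"
      unfolding Y_def[symmetric] by (simp only: ennreal_add_left_cancel_le) auto
    then show ?thesis
      using real w by (simp add: divide_ennreal ennreal_mult)
  next
    case top
    then have "top \<le> ?R + ennreal (r * w)"
      using key[of 1] r by (simp add: ennreal_mult_top)
    then have "?R = top" by (simp add: top_unique)
    then show ?thesis by simp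
  qed
qed

section \<open>Hardy's inequality for averages of a distribution function\<close>

text \<open>
  The interval from \<open>0\<close> to \<open>min (q powr k) m\<close> is cut at the points \<open>q powr j\<close>, \<open>j < k\<close>; the lengths
  of the pieces form a telescoping series.
\<close>

lemma suminf_min_layers:
  assumes q: "1 < q"
  shows "(\<Sum>i. min (ennreal (q powr (k - int i))) m - min (ennreal (q powr (k - int i - 1))) m)
           = min (ennreal (q powr k)) m"
proof -
  define g where "g i = enn2real (min (ennreal (q powr (k - real i))) m)" for i :: nat
  have g: "min (ennreal (q powr (k - real i))) m = ennreal (g i)" for i
    by (auto simp: g_def ennreal_enn2real_if min_def)
  have g0: "0 \<le> g i" for i by (simp add: g_def)
  have gle: "g i \<le> q powr (k - real i)" for i
    using g[of i] by (metis ennreal_le_iff min.cobounded1 powr_ge_zero)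
  have dec: "g (Suc i) \<le> g i" for i
  proof -
    have "ennreal (q powr (k - real (Suc i))) \<le> ennreal (q powr (k - real i))"
      using q by (intro ennreal_leI powr_mono) auto
    then have "ennreal (g (Suc i)) \<le> ennreal (g i)"
      unfolding g[symmetric] by (rule min.mono) simp
    then show ?thesis using g0 by simp
  qed
  have "(\<lambda>i. q powr k * q powr (- 1 * real i)) \<longlonglongrightarrow> q powr k * 0"
    using sums_summable[OF geometric_powr_sums[OF q, of 1]]
    by (intro tendsto_mult tendsto_const summable_LIMSEQ_zero) simp
  then have "(\<lambda>i. q powr (k - real i)) \<longlonglongrightarrow> 0"
    by (simp add: powr_diff powr_minus_divide)
  then have "g \<longlonglongrightarrow> 0"
    by (rule tendsto_sandwich[rotated 2, OF tendsto_const]) (auto simp: g0 gle)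
  then have sums: "(\<lambda>i. g i - g (Suc i)) sums (g 0 - 0)"
    by (rule telescope_sums')
  have "min (ennreal (q powr (k - int i))) m - min (ennreal (q powr (k - int i - 1))) m = ennreal (g i - g (Suc i))" for i
  proof -
    have "real_of_int (k - int i - 1) = real_of_int k - real (Suc i)" by simp
    then have "min (ennreal (q powr (k - int i - 1))) m = ennreal (g (Suc i))"
      using g[of "Suc i"] by (simp only:)
    moreover have "min (ennreal (q powr (k - int i))) m = ennreal (g i)"
      using g[of i] by simp
    ultimately show ?thesis by (simp add: ennreal_minus g0)
  qed
  then have "(\<Sum>i. min (ennreal (q powr (k - int i))) m - min (ennreal (q powr (k - int i - 1))) m) = (\<Sum>i. ennreal (g i - g (Suc i)))"
    by (simp only:)
  also have "\<dots> = ennreal (g 0 - 0)"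
    by (rule suminf_ennreal_eq[OF _ sums]) (simp add: dec)
  also have "\<dots> = min (ennreal (q powr k)) m"
    using g[of 0] by simp
  finally show ?thesis .
qed

lemma nn_integral_min_layers_le:
  assumes q: "1 < q"
  shows "(\<integral>\<^sup>+j. min (ennreal (q powr real_of_int j)) m - min (ennreal (q powr (real_of_int j - 1))) m \<partial>count_space UNIV) \<le> m"
proof -
  define c where "c j = min (ennreal (q powr real_of_int j)) m - min (ennreal (q powr (real_of_int j - 1))) m" for j
  have "(\<integral>\<^sup>+j. c j \<partial>count_space UNIV) = (\<integral>\<^sup>+j. (SUP n. c j * indicator {..int n} j) \<partial>count_space UNIV)"
  proof (intro nn_integral_cong)
    fix j
    show "c j = (SUP n. c j * indicator {..int n} j)"
    proof (rule antisym)
      have "c j = c j * indicator {..int (nat j)} j" by simp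
      also have "\<dots> \<le> (SUP n. c j * indicator {..int n} j)" by (rule SUP_upper) simp
      finally show "c j \<le> (SUP n. c j * indicator {..int n} j)" .
    qed (auto intro!: SUP_least simp: indicator_def)
  qed
  also have "\<dots> = (SUP n. \<integral>\<^sup>+j. c j * indicator {..int n} j \<partial>count_space UNIV)"
    by (rule nn_integral_monotone_convergence_SUP) (auto simp: incseq_def le_fun_def indicator_def)
  also have "\<dots> = (SUP n. min (ennreal (q powr int n)) m)"
    using suminf_min_layers[OF q, of "int _" m] by (simp add: nn_integral_atMost_int c_def)
  also have "\<dots> \<le> m"
    by (rule SUP_least) simp
  finally show ?thesis by (simp add: c_def)
qed

text \<open>
  Suppose that \<open>m\<close> is the distribution function of a function \<open>\<psi>\<close>, and let \<open>\<psi>\<^sup>*\<close> be the decreasing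
  rearrangement of \<open>\<psi>\<close> on the half-line. Then the inner integral on the left is the mean value of \<open>\<psi>\<^sup>*\<close> over
  the interval from \<open>0\<close> to \<open>q powr k\<close>, while the integral on the right is that of \<open>\<psi>\<^sup>* powr r\<close>. So
  this is Hardy's inequality for \<open>\<psi>\<^sup>*\<close>, with intervals of length \<open>q powr k\<close> only. It follows from
  \<open>discrete_Hardy\<close> for the mean values \<open>A j\<close> of \<open>\<psi>\<^sup>*\<close> between \<open>q powr (j - 1)\<close> and \<open>q powr j\<close>, and
  Jensen's inequality on each of these intervals. The rearrangement itself does not occur in the
  proof: the integral of \<open>\<psi>\<^sup>*\<close> over the \<open>j\<close>-th interval is that of \<open>c j\<close>, and Jensen's inequality
  is \<open>bathtub_powr\<close>.
\<close>

lemma Hardy_distribution: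
  assumes q: "1 < q" and r: "1 < r" and [measurable]: "m \<in> borel_measurable half_line"
  shows "(\<integral>\<^sup>+k. ennreal ((1 - 1 / q) * q powr real_of_int k) *
             ennreal_powr (\<integral>\<^sup>+s. min 1 (ennreal (q powr - real_of_int k) * m s) \<partial>half_line) r \<partial>count_space UNIV)
          \<le> ennreal (((1 - 1 / q) / (1 - q powr (- (1 - 1 / r)))) powr r) *
             (\<integral>\<^sup>+s. ennreal (r * s powr (r - 1)) * m s \<partial>half_line)"
proof -
  define \<delta> where "\<delta> = 1 - 1 / q"
  have \<delta>: "0 < \<delta>" using q by (simp add: \<delta>_def)
  define c where "c j s = min (ennreal (q powr real_of_int j)) (m s) - min (ennreal (q powr (real_of_int j - 1))) (m s)" for j s
  define w where "w j = \<delta> * q powr real_of_int j" for j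
  define A where "A j = (\<integral>\<^sup>+s. c j s \<partial>half_line) / ennreal (w j)" for j
  have w: "0 < w j" for j using \<delta> q by (simp add: w_def)
  have [measurable]: "c j \<in> borel_measurable half_line" for j
    unfolding c_def by measurable
  have c_le: "c j s \<le> ennreal (w j)" for j s
  proof -
    define b where "b = q powr (real_of_int j - 1)"
    have b: "0 < b" "q powr real_of_int j = b + w j"
      using q by (auto simp: b_def w_def \<delta>_def powr_diff field_simps)
    have "c j s = min (ennreal b + ennreal (w j)) (m s) - min (ennreal b) (m s)"
      using b w[of j] by (simp add: c_def b_def[symmetric])
    also have "\<dots> \<le> ennreal (w j)"
    proof (cases "m s \<le> ennreal b")
      case True
      then have "m s \<le> ennreal b + ennreal (w j)" by (rule order_trans) simp
      then show ?thesis using True by (cases "m s") (auto simp: min_absorb2 ennreal_minus top_unique)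
    next
      case False
      then show ?thesis using b w[of j]
        by (cases "m s") (auto simp: min_def ennreal_minus simp flip: ennreal_plus intro!: ennreal_leI)
    qed
    finally show ?thesis .
  qed
  have U: "(\<integral>\<^sup>+s. min 1 (ennreal (q powr - real_of_int k) * m s) \<partial>half_line)
      = ennreal \<delta> * (\<Sum>i. ennreal (q powr (- real i)) * A (k - int i))" for k
  proof -
    have scale: "min 1 (ennreal (q powr - real_of_int k) * t) = ennreal (q powr - real_of_int k) * min (ennreal (q powr real_of_int k)) t" for t
    proof -
      have *: "ennreal (q powr - real_of_int k) * ennreal (q powr real_of_int k) = 1"
        using q by (simp flip: ennreal_mult powr_add)
      have "min (ennreal (q powr - real_of_int k) * ennreal (q powr real_of_int k)) (ennreal (q powr - real_of_int k) * t)
         = ennreal (q powr - real_of_int k) * min (ennreal (q powr real_of_int k)) t"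
        by (cases "ennreal (q powr real_of_int k) \<le> t")
          (auto simp: min_absorb1 min_absorb2 mult_left_mono not_le less_imp_le)
      then show ?thesis by (simp only: *)
    qed
    have "(\<integral>\<^sup>+s. min 1 (ennreal (q powr - real_of_int k) * m s) \<partial>half_line)
      = (\<integral>\<^sup>+s. ennreal (q powr - real_of_int k) * (\<Sum>i. c (k - int i) s) \<partial>half_line)"
      using suminf_min_layers[OF q, of k] by (simp add: scale c_def)
    also have "\<dots> = ennreal (q powr - real_of_int k) * (\<Sum>i. \<integral>\<^sup>+s. c (k - int i) s \<partial>half_line)"
      by (simp add: nn_integral_cmult nn_integral_suminf)
    also have "\<dots> = ennreal (q powr - real_of_int k) * (\<Sum>i. ennreal (w (k - int i)) * A (k - int i))"
    proof -
      have "(\<integral>\<^sup>+s. c j s \<partial>half_line) = ennreal (w j) * A j" for j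
        using w[of j] unfolding A_def ennreal_times_divide
        by (subst mult.commute[of "ennreal (w j)"]) (auto simp: ennreal_mult_divide_eq)
      then show ?thesis by (simp only:)
    qed
    also have "\<dots> = (\<Sum>i. ennreal \<delta> * (ennreal (q powr (- real i)) * A (k - int i)))"
    proof -
      have "ennreal (q powr - real_of_int k) * (ennreal (w (k - int i)) * t) = ennreal \<delta> * (ennreal (q powr (- real i)) * t)" for i t
      proof -
        have "q powr - real_of_int k * w (k - int i) = \<delta> * q powr (- real i)"
          using q by (simp add: w_def mult.left_commute flip: powr_add)
        then have "ennreal (q powr - real_of_int k) * ennreal (w (k - int i)) = ennreal \<delta> * ennreal (q powr (- real i))"
          using \<delta> w[of "k - int i"] by (simp add: ennreal_mult[symmetric])
        then show ?thesis by (simp only: mult.assoc[symmetric])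
      qed
      then show ?thesis by (simp only: ennreal_suminf_cmult[symmetric])
    qed
    finally show ?thesis by simp
  qed
  define W where "W = 1 / (1 - q powr (- (1 - 1 / r)))"
  have W: "0 < W" using q r by (simp add: W_def powr_less_one)
  define S where "S = (\<integral>\<^sup>+k. ennreal (q powr real_of_int k) * ennreal_powr (A k) r \<partial>count_space UNIV)"
  have "(\<integral>\<^sup>+k. ennreal (\<delta> * q powr real_of_int k) *
             ennreal_powr (\<integral>\<^sup>+s. min 1 (ennreal (q powr - real_of_int k) * m s) \<partial>half_line) r \<partial>count_space UNIV)
      = (\<integral>\<^sup>+k. ennreal (\<delta> * \<delta> powr r) * (ennreal (q powr real_of_int k) *
             ennreal_powr (\<Sum>i. ennreal (q powr (- real i)) * A (k - int i)) r) \<partial>count_space UNIV)"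
    using \<delta> unfolding U ennreal_powr_cmult[OF \<delta>] by (simp add: ennreal_mult mult_ac)
  also have "\<dots> \<le> ennreal (\<delta> * \<delta> powr r) * (ennreal (W powr r) * S)"
    unfolding S_def W_def
    by (subst nn_integral_cmult, simp) (intro mult_left_mono discrete_Hardy q r, simp)
  also have "\<dots> = ennreal ((\<delta> * W) powr r) * (ennreal \<delta> * S)"
    using \<delta> W by (simp add: powr_mult ennreal_mult mult_ac)
  also have "ennreal \<delta> * S = (\<integral>\<^sup>+k. ennreal (w k) * ennreal_powr (A k) r \<partial>count_space UNIV)"
    using \<delta> by (simp add: S_def w_def ennreal_mult mult.assoc nn_integral_cmult)
  also have "\<dots> \<le> (\<integral>\<^sup>+k. \<integral>\<^sup>+s. ennreal (r * s powr (r - 1)) * c k s \<partial>half_line \<partial>count_space UNIV)"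
    unfolding A_def by (intro nn_integral_mono bathtub_powr c_le w r) simp
  also have "\<dots> = (\<integral>\<^sup>+s. \<integral>\<^sup>+k. ennreal (r * s powr (r - 1)) * c k s \<partial>count_space UNIV \<partial>half_line)"
  proof (rule nn_integral_count_space_nn_integral[symmetric])
    have [measurable]: "(\<lambda>s. ennreal (r * s powr (r - 1))) \<in> borel_measurable half_line"
      by (rule measurable_half_line) measurable
    show "(\<lambda>s. ennreal (r * s powr (r - 1)) * c k s) \<in> borel_measurable half_line" for k
      by measurable
  qed simp
  also have "\<dots> \<le> (\<integral>\<^sup>+s. ennreal (r * s powr (r - 1)) * m s \<partial>half_line)"
    using nn_integral_min_layers_le[OF q]
    by (intro nn_integral_mono) (auto simp: nn_integral_cmult c_def intro!: mult_left_mono)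
  finally show ?thesis
    by (simp add: mult_left_mono \<delta>_def W_def)
qed

section \<open>Lower integrals\<close>

text \<open>
  The function \<open>f\<close> is arbitrary, and its integral is the supremum of the integrals of the
  measurable functions below it: its lower integral, which is monotone but in general not
  additive. Since the supremum is attained, estimates for measurable functions carry over.
\<close>

lemma nn_integral_attained:
  obtains h where "h \<in> borel_measurable M" "\<And>x. h x \<le> f x" "(\<integral>\<^sup>+x. h x \<partial>M) = (\<integral>\<^sup>+x. f x \<partial>M)"
proof -
  define G where "G = {g. simple_function M g \<and> g \<le> f}"
  have "(\<lambda>x. 0) \<in> G" by (simp add: G_def le_fun_def)
  then have "G \<noteq> {}" by auto
  then obtain ys :: "nat \<Rightarrow> ennreal" where ys: "range ys \<subseteq> integral\<^sup>S M ` G" "Sup (integral\<^sup>S M ` G) = Sup (range ys)"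
    using ennreal_SUP_countable_SUP[of G "integral\<^sup>S M"] by auto
  then have "\<forall>n. \<exists>g\<in>G. ys n = integral\<^sup>S M g" by auto
  then obtain g where g: "\<And>n. g n \<in> G" "\<And>n. ys n = integral\<^sup>S M (g n)" by metis
  define h where "h x = (SUP n. g n x)" for x
  have [measurable]: "g n \<in> borel_measurable M" for n
    using g(1)[of n] by (auto simp: G_def intro: borel_measurable_simple_function)
  have meas: "h \<in> borel_measurable M"
    unfolding h_def by measurable
  have le: "h x \<le> f x" for x
    using g(1) by (auto simp: h_def G_def le_fun_def intro!: SUP_least)
  have "(\<integral>\<^sup>+x. f x \<partial>M) = (SUP n. ys n)"
    unfolding nn_integral_def using ys(2) by (simp add: G_def)
  also have "\<dots> = (SUP n. \<integral>\<^sup>+x. g n x \<partial>M)"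
    using g by (simp add: G_def nn_integral_eq_simple_integral)
  also have "\<dots> \<le> (\<integral>\<^sup>+x. h x \<partial>M)"
    by (intro SUP_least nn_integral_mono) (auto simp: h_def intro: SUP_upper)
  finally have "(\<integral>\<^sup>+x. f x \<partial>M) \<le> (\<integral>\<^sup>+x. h x \<partial>M)" .
  moreover have "(\<integral>\<^sup>+x. h x \<partial>M) \<le> (\<integral>\<^sup>+x. f x \<partial>M)"
    by (intro nn_integral_mono le)
  ultimately have "(\<integral>\<^sup>+x. h x \<partial>M) = (\<integral>\<^sup>+x. f x \<partial>M)"
    by (rule antisym[rotated])
  with meas le show ?thesis by (rule that)
qed

section \<open>Hardy's inequality for balls of at most geometric measure\<close>

lemma suminf_geometric_layers:
  assumes q: "1 < q"
  shows "(\<Sum>i. ennreal ((1 - 1 / q) * q powr real_of_int (k - int i))) = ennreal (q powr real_of_int k)"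
proof (rule suminf_ennreal_eq)
  have "(\<lambda>i. (1 - 1 / q) * q powr k * q powr (- 1 * real i)) sums ((1 - 1 / q) * q powr k * (1 / (1 - q powr (- 1))))"
    by (intro sums_mult geometric_powr_sums q) simp
  moreover have "(1 - 1 / q) * q powr k * (1 / (1 - q powr (- 1))) = q powr k"
    using q by (simp add: powr_minus_divide)
  ultimately show "(\<lambda>i. (1 - 1 / q) * q powr real_of_int (k - int i)) sums (q powr real_of_int k)"
    using q by (simp add: powr_diff powr_minus_divide)
qed (use q in simp)

text \<open>
  The balls \<open>B k\<close> of this statement need not be measurable, and the integrals of \<open>f\<close> over them are
  lower integrals; only the measure of their measurable subsets is bounded. Two ideas make up
  for this. First, one measurable function \<open>\<psi> \<le> f\<close> serves all balls: it is the supremum of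
  functions \<open>g k\<close> that attain the lower integrals of \<open>f\<close> over the \<open>B k\<close>. Since \<open>g k\<close> lives on a set
  of measure at most \<open>q powr k\<close>, its layer cake formula bounds the average of \<open>f\<close> over \<open>B k\<close> by
  \<open>U k\<close>, the average of the decreasing rearrangement of \<open>\<psi>\<close> over an interval of length \<open>q powr k\<close>.
  Secondly, \<open>U k\<close> decreases with \<open>k\<close>, which the averages of \<open>f\<close> need not do. Hence a measurable
  function \<open>h\<close> below the left integrand exceeds a level only inside a ball, so that the
  distribution function of \<open>h\<close> is controlled by the measure of balls as well, and the claim is
  reduced to \<open>Hardy_distribution\<close>.
\<close>

theorem Hardy_nn_integral:
  fixes av :: "'a \<Rightarrow> real" and f :: "'a \<Rightarrow> ennreal"
  assumes q: "1 < q" and r: "1 < r" and sf: "sigma_finite_measure M"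
    and range: "\<And>x. x \<in> space M \<Longrightarrow> av x = 0 \<or> (\<exists>k::int. av x = q powr k)"
    and small: "\<And>D (k::int). D \<in> sets M \<Longrightarrow> (\<And>x. x \<in> D \<Longrightarrow> av x \<le> q powr k) \<Longrightarrow> emeasure M D \<le> ennreal (q powr k)"
  shows "(\<integral>\<^sup>+x. ennreal_powr (ennreal (1 / av x) * (\<integral>\<^sup>+y. f y * indicator {y. av y \<le> av x} y \<partial>M)) r \<partial>M)
      \<le> ennreal (((1 - 1 / q) / (1 - q powr (- (1 - 1 / r)))) powr r) * (\<integral>\<^sup>+x. ennreal_powr (f x) r \<partial>M)"
    (is "(\<integral>\<^sup>+x. ennreal_powr (?V x) r \<partial>M) \<le> ennreal ?C * _")
proof -
  define B where "B k = {y. av y \<le> q powr real_of_int k}" for k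
  have "\<exists>g. g \<in> borel_measurable M \<and> (\<forall>x. g x \<le> f x * indicator (B k) x) \<and> (\<integral>\<^sup>+x. g x \<partial>M) = (\<integral>\<^sup>+x. f x * indicator (B k) x \<partial>M)" for k
    by (rule nn_integral_attained[of M "\<lambda>x. f x * indicator (B k) x"]) blast
  then obtain g where g [measurable]: "\<And>k. g k \<in> borel_measurable M"
    and g_le: "\<And>k x. g k x \<le> f x * indicator (B k) x"
    and g_eq: "\<And>k. (\<integral>\<^sup>+x. g k x \<partial>M) = (\<integral>\<^sup>+x. f x * indicator (B k) x \<partial>M)"
    by metis
  define \<psi> where "\<psi> x = (SUP k. g k x)" for x
  have [measurable]: "\<psi> \<in> borel_measurable M"
    unfolding \<psi>_def by measurable
  have \<psi>_le: "\<psi> x \<le> f x" for x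
    unfolding \<psi>_def by (intro SUP_least order_trans[OF g_le]) (auto simp: indicator_def)
  define m where "m s = emeasure M {x \<in> space M. ennreal s < \<psi> x}" for s
  have m_meas [measurable]: "m \<in> borel_measurable half_line"
    unfolding m_def by (rule borel_measurable_distribution[OF sf]) simp
  define U where "U k = (\<integral>\<^sup>+s. min 1 (ennreal (q powr - real_of_int k) * m s) \<partial>half_line)" for k
  have U_antimono: "U k \<le> U j" if "j \<le> k" for j k
    unfolding U_def using q that
    by (intro nn_integral_mono min.mono mult_right_mono ennreal_leI powr_mono) auto
  have avg_le: "ennreal (q powr - real_of_int k) * (\<integral>\<^sup>+x. f x * indicator (B k) x \<partial>M) \<le> U k" for k
  proof -
    have "(\<integral>\<^sup>+x. g k x \<partial>M) = (\<integral>\<^sup>+s. emeasure M {x \<in> space M. ennreal s < g k x} \<partial>half_line)"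
      by (rule layer_cake[OF sf]) simp
    then have "ennreal (q powr - real_of_int k) * (\<integral>\<^sup>+x. f x * indicator (B k) x \<partial>M)
      = ennreal (q powr - real_of_int k) * (\<integral>\<^sup>+s. emeasure M {x \<in> space M. ennreal s < g k x} \<partial>half_line)"
      by (simp add: g_eq)
    also have "\<dots> \<le> ennreal (q powr - real_of_int k) * (\<integral>\<^sup>+s. min (ennreal (q powr real_of_int k)) (m s) \<partial>half_line)"
    proof (intro mult_left_mono nn_integral_mono min.boundedI)
      fix s :: real
      show "emeasure M {x \<in> space M. ennreal s < g k x} \<le> ennreal (q powr real_of_int k)"
      proof (rule small)
        fix x assume "x \<in> {x \<in> space M. ennreal s < g k x}"
        then have "0 < f x * indicator (B k) x"
          using g_le[of k x] by (auto intro: le_less_trans[OF zero_le] less_le_trans)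
        then show "av x \<le> q powr real_of_int k"
          by (cases "x \<in> B k") (auto simp: B_def)
      qed measurable
      show "emeasure M {x \<in> space M. ennreal s < g k x} \<le> m s"
        unfolding m_def
        by (intro emeasure_mono) (auto simp: \<psi>_def less_SUP_iff)
    qed simp
    also have "\<dots> = (\<integral>\<^sup>+s. ennreal (q powr - real_of_int k) * min (ennreal (q powr real_of_int k)) (m s) \<partial>half_line)"
      by (simp add: nn_integral_cmult)
    also have "\<dots> \<le> U k"
      unfolding U_def
    proof (intro nn_integral_mono min.boundedI)
      fix s
      have "ennreal (q powr - real_of_int k) * min (ennreal (q powr real_of_int k)) (m s) \<le> ennreal (q powr - real_of_int k) * ennreal (q powr real_of_int k)"
        by (intro mult_left_mono) auto
      also have "\<dots> = 1" using q by (simp flip: ennreal_mult powr_add)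
      finally show "ennreal (q powr - real_of_int k) * min (ennreal (q powr real_of_int k)) (m s) \<le> 1" .
    qed (auto intro: mult_left_mono)
    finally show ?thesis .
  qed
  obtain h where h [measurable]: "h \<in> borel_measurable M" and h_le: "\<And>x. h x \<le> ennreal_powr (?V x) r"
    and h_eq: "(\<integral>\<^sup>+x. h x \<partial>M) = (\<integral>\<^sup>+x. ennreal_powr (?V x) r \<partial>M)"
    by (rule nn_integral_attained[of M "\<lambda>x. ennreal_powr (?V x) r"]) blast
  define w where "w k = ennreal ((1 - 1 / q) * q powr real_of_int k)" for k
  \<comment> \<open>At points with \<open>av x = 0\<close> the factor \<open>1 / av x\<close> is \<open>0\<close>, so they lie in no level set of \<open>h\<close>.\<close>
  have h_U: "\<exists>k. av x = q powr real_of_int k \<and> ennreal s < ennreal_powr (U k) r"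
    if x: "x \<in> space M" and s: "ennreal s < h x" for x s
  proof -
    have pos: "ennreal s < ennreal_powr (?V x) r" using s h_le[of x] by (rule less_le_trans)
    then have "av x \<noteq> 0" by auto
    then obtain k where k: "av x = q powr real_of_int k" using range[OF x] by auto
    have "?V x \<le> U k"
      using avg_le[of k] q by (simp add: k B_def powr_minus_divide)
    then have "ennreal_powr (?V x) r \<le> ennreal_powr (U k) r" using r by (intro ennreal_powr_mono) auto
    with pos k show ?thesis by (auto intro: less_le_trans)
  qed
  have level: "emeasure M {x \<in> space M. ennreal s < h x}
      \<le> (\<integral>\<^sup>+k. w k * indicator {s. ennreal s < ennreal_powr (U k) r} s \<partial>count_space UNIV)" for s
  proof -
    \<comment> \<open>The radii at which the level \<open>s\<close> is exceeded form a down-closed set \<open>K\<close>. If \<open>K\<close> has a largest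
    element, the level set of \<open>h\<close> lies in the ball of that radius; if \<open>K\<close> is unbounded, the right-hand
    side is infinite.\<close>
    define K where "K = {k. ennreal s < ennreal_powr (U k) r}"
    have K_down: "j \<in> K" if "k \<in> K" "j \<le> k" for j k
      using that ennreal_powr_mono[OF U_antimono[OF that(2)], of r] r by (auto simp: K_def intro: less_le_trans)
    have sum_ge: "ennreal (q powr real_of_int k) \<le> (\<integral>\<^sup>+k. w k * indicator {s. ennreal s < ennreal_powr (U k) r} s \<partial>count_space UNIV)"
      if "k \<in> K" for k
    proof -
      have "ennreal (q powr real_of_int k) = (\<integral>\<^sup>+j. w j * indicator {..k} j \<partial>count_space UNIV)"
        unfolding nn_integral_atMost_int w_def by (rule suminf_geometric_layers[OF q, symmetric])
      also have "\<dots> \<le> (\<integral>\<^sup>+k. w k * indicator {s. ennreal s < ennreal_powr (U k) r} s \<partial>count_space UNIV)"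
        using K_down[OF that] by (intro nn_integral_mono) (auto simp: indicator_def K_def)
      finally show ?thesis .
    qed
    show ?thesis
    proof (cases "K = {}")
      case True
      then have "{x \<in> space M. ennreal s < h x} = {}" using h_U[of _ s] by (auto simp: K_def)
      then show ?thesis by (simp only: emeasure_empty zero_le)
    next
      case nonempty: False
      show ?thesis
      proof (cases "bdd_above K")
        case True
        then obtain b where b: "\<And>k. k \<in> K \<Longrightarrow> k \<le> b" by (auto simp: bdd_above_def)
        obtain a where a: "a \<in> K" using nonempty by blast
        define t where "t = Max (K \<inter> {a..b})"
        have t: "t \<in> K \<inter> {a..b}"
          unfolding t_def using a b by (intro Max_in) auto
        have max: "t \<in> K" "k \<le> t" if "k \<in> K" for k
        proof -
          show "t \<in> K" using t by blast
          show "k \<le> t"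
          proof (cases "a \<le> k")
            case True
            then show ?thesis unfolding t_def using that b by (intro Max_ge) auto
          qed (use t in auto)
        qed
        have "emeasure M {x \<in> space M. ennreal s < h x} \<le> ennreal (q powr real_of_int (t))"
        proof (rule small)
          fix x assume "x \<in> {x \<in> space M. ennreal s < h x}"
          then obtain k where "av x = q powr real_of_int k" "k \<in> K" using h_U[of x s] by (auto simp: K_def)
          then show "av x \<le> q powr real_of_int (t)" using max(2)[of k] q by (auto intro!: powr_mono)
        qed measurable
        also note sum_ge[OF max(1)[OF a]]
        finally show ?thesis .
      next
        case False
        have "of_nat n \<le> (\<integral>\<^sup>+k. w k * indicator {s. ennreal s < ennreal_powr (U k) r} s \<partial>count_space UNIV)" for n :: nat
        proof -
          obtain N :: nat where N: "real n < q ^ N" using real_arch_pow[OF q] by blast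
          obtain k where k: "k \<in> K" "int N < k" using False by (auto simp: bdd_above_def not_le)
          have "real n \<le> q powr real_of_int k"
          proof -
            have "q ^ N = q powr real N" using q by (simp add: powr_realpow)
            also have "\<dots> \<le> q powr real_of_int k" using q k by (intro powr_mono) auto
            finally show ?thesis using N by simp
          qed
          then have "of_nat n \<le> ennreal (q powr real_of_int k)"
            by (simp add: ennreal_of_nat_eq_real_of_nat ennreal_leI)
          also note sum_ge[OF k(1)]
          finally show ?thesis .
        qed
        then have "(\<integral>\<^sup>+k. w k * indicator {s. ennreal s < ennreal_powr (U k) r} s \<partial>count_space UNIV) = top"
          using ennreal_Ex_less_of_nat leD less_top by blast
        then show ?thesis by simp
      qed
    qed
  qed
  have "(\<integral>\<^sup>+x. ennreal_powr (?V x) r \<partial>M) = (\<integral>\<^sup>+s. emeasure M {x \<in> space M. ennreal s < h x} \<partial>half_line)"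
    unfolding h_eq[symmetric] by (rule layer_cake[OF sf h])
  also have "\<dots> \<le> (\<integral>\<^sup>+s. \<integral>\<^sup>+k. w k * indicator {s. ennreal s < ennreal_powr (U k) r} s \<partial>count_space UNIV \<partial>half_line)"
    by (intro nn_integral_mono level)
  also have "\<dots> = (\<integral>\<^sup>+k. \<integral>\<^sup>+s. w k * indicator {s. ennreal s < ennreal_powr (U k) r} s \<partial>half_line \<partial>count_space UNIV)"
    by (rule nn_integral_count_space_nn_integral) (auto intro!: measurable_half_line)
  also have "\<dots> = (\<integral>\<^sup>+k. w k * ennreal_powr (U k) r \<partial>count_space UNIV)"
  proof (intro nn_integral_cong)
    fix k
    have [measurable]: "indicator {s. ennreal s < ennreal_powr (U k) r} \<in> borel_measurable half_line"
      by (rule measurable_half_line) measurable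
    show "(\<integral>\<^sup>+s. w k * indicator {s. ennreal s < ennreal_powr (U k) r} s \<partial>half_line) = w k * ennreal_powr (U k) r"
      by (simp add: nn_integral_cmult nn_integral_half_line_indicator)
  qed
  also have "\<dots> \<le> ennreal ?C * (\<integral>\<^sup>+s. ennreal (r * s powr (r - 1)) * m s \<partial>half_line)"
    unfolding w_def U_def by (rule Hardy_distribution[OF q r m_meas])
  also have "(\<integral>\<^sup>+s. ennreal (r * s powr (r - 1)) * m s \<partial>half_line) = (\<integral>\<^sup>+x. ennreal_powr (\<psi> x) r \<partial>M)"
    unfolding m_def using r by (intro layer_cake_powr[OF sf, symmetric]) auto
  also have "\<dots> \<le> (\<integral>\<^sup>+x. ennreal_powr (f x) r \<partial>M)"
    using r by (intro nn_integral_mono ennreal_powr_mono \<psi>_le) auto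
  finally show ?thesis by (simp add: mult_left_mono)
qed

section \<open>The p-adic absolute value on the rationals\<close>

lemma rat_padic_abs_zero [simp]: "rat_padic_abs p 0 = 0"
  by (simp add: rat_padic_abs_def)

lemma rat_padic_abs_nonneg [simp]: "0 \<le> rat_padic_abs p q"
  by (simp add: rat_padic_abs_def)

lemma rat_padic_abs_pos: "prime p \<Longrightarrow> q \<noteq> 0 \<Longrightarrow> 0 < rat_padic_abs p q"
  using prime_gt_0_nat[of p] by (simp add: rat_padic_abs_def)

lemma rat_padic_abs_quotient:
  fixes a b :: int
  assumes p: "prime p" and "a \<noteq> 0" "b \<noteq> 0"
  shows "rat_padic_abs p (of_int a / of_int b)
           = real p powi (int (multiplicity (int p) b) - int (multiplicity (int p) a))"
proof -
  define q :: rat where "q = of_int a / of_int b"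
  obtain n d where nd: "quotient_of q = (n, d)" by (cases "quotient_of q")
  have d: "d > 0" using quotient_of_denom_pos[OF nd] .
  have q: "q = of_int n / of_int d" using quotient_of_div[OF nd] .
  have "q \<noteq> 0" using assms by (simp add: q_def)
  then have n: "n \<noteq> 0" using q by auto
  have "of_int (a * d) = (of_int (n * b) :: rat)"
    using q d assms by (simp add: q_def field_simps)
  then have "a * d = n * b" by (simp only: of_int_eq_iff)
  then have "multiplicity (int p) (a * d) = multiplicity (int p) (n * b)" by simp
  then have "multiplicity (int p) a + multiplicity (int p) d = multiplicity (int p) n + multiplicity (int p) b"
    using assms n d by (simp add: prime_elem_multiplicity_mult_distrib)
  then have "- rat_padic_val p q = int (multiplicity (int p) b) - int (multiplicity (int p) a)"
    by (simp add: rat_padic_val_def nd)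
  then show ?thesis
    using \<open>q \<noteq> 0\<close> by (simp add: rat_padic_abs_def q_def)
qed

lemma rat_quotient_cases:
  fixes q :: rat
  obtains (zero) "q = 0" | (quotient) a b where "q = of_int a / of_int b" "a \<noteq> 0" "0 < b" "coprime a b"
proof (cases "q = 0")
  case False
  obtain n d where nd: "quotient_of q = (n, d)" by (cases "quotient_of q")
  then have "q = of_int n / of_int d" "0 < d" "coprime n d"
    using quotient_of_div quotient_of_denom_pos quotient_of_coprime by blast+
  with False that(2)[of n d] show thesis by auto
qed (rule that(1))

lemma rat_padic_abs_powi: "prime p \<Longrightarrow> q \<noteq> 0 \<Longrightarrow> \<exists>k. rat_padic_abs p q = real p powi k"
  by (auto simp: rat_padic_abs_def)

lemma rat_padic_abs_mult:
  assumes p: "prime p"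
  shows "rat_padic_abs p (q * r) = rat_padic_abs p q * rat_padic_abs p r"
proof (cases q rule: rat_quotient_cases)
  case q: (quotient a b)
  show ?thesis
  proof (cases r rule: rat_quotient_cases)
    case r: (quotient c d)
    have "q * r = of_int (a * c) / of_int (b * d)" using q r by simp
    then have "rat_padic_abs p (q * r)
        = real p powi (int (multiplicity (int p) (b * d)) - int (multiplicity (int p) (a * c)))"
      using q r by (simp only:) (intro rat_padic_abs_quotient p, auto)
    also have "\<dots> = real p powi ((int (multiplicity (int p) b) - int (multiplicity (int p) a))
                              + (int (multiplicity (int p) d) - int (multiplicity (int p) c)))"
      using p q r by (simp add: prime_elem_multiplicity_mult_distrib algebra_simps)
    also have "\<dots> = rat_padic_abs p q * rat_padic_abs p r"
      using p q r prime_gt_0_nat[OF p]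
      by (simp add: rat_padic_abs_quotient power_int_add)
    finally show ?thesis .
  qed simp
qed simp

lemma rat_padic_abs_minus:
  assumes p: "prime p"
  shows "rat_padic_abs p (- q) = rat_padic_abs p q"
proof -
  have "rat_padic_abs p (- 1) = 1"
    using rat_padic_abs_quotient[OF p, of "- 1" 1] by (simp add: multiplicity_unit_right)
  then show ?thesis
    using rat_padic_abs_mult[OF p, of "- 1" q] by simp
qed

lemma rat_padic_abs_le_1_cases:
  assumes p: "prime p" and "rat_padic_abs p q \<le> 1"
  obtains a b where "q = of_int a / of_int b" "b \<noteq> 0" "\<not> int p dvd b"
proof (cases q rule: rat_quotient_cases)
  case zero
  then show ?thesis using that[of 0 1] prime_gt_1_nat[OF p] by simp
next
  case (quotient a b)
  have "\<not> int p dvd b"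
  proof
    assume b: "int p dvd b"
    then have "\<not> int p dvd a"
      using quotient p by (metis coprime_common_divisor not_prime_unit prime_nat_int_transfer)
    then have "multiplicity (int p) a = 0" by (rule not_dvd_imp_multiplicity_0)
    moreover have "0 < multiplicity (int p) b"
      using b quotient p by (simp add: prime_multiplicity_gt_zero_iff)
    ultimately have "1 < rat_padic_abs p q"
      using quotient p prime_gt_1_nat[OF p] by (simp add: rat_padic_abs_quotient one_less_power)
    then show False using assms by simp
  qed
  then show ?thesis using that quotient by auto
qed

lemma rat_padic_abs_of_int_le_iff:
  assumes p: "prime p"
  shows "rat_padic_abs p (of_int a) \<le> real p powi (- int n) \<longleftrightarrow> int p ^ n dvd a"
proof (cases "a = 0")
  case False
  have "rat_padic_abs p (of_int a) = real p powi (- int (multiplicity (int p) a))"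
    using rat_padic_abs_quotient[OF p False, of 1] by simp
  also have "\<dots> \<le> real p powi (- int n) \<longleftrightarrow> n \<le> multiplicity (int p) a"
    using prime_gt_1_nat[OF p] by (simp add: power_int_minus inverse_le_iff_le)
  also have "\<dots> \<longleftrightarrow> int p ^ n dvd a"
    using False p by (intro power_dvd_iff_le_multiplicity[symmetric]) auto
  finally show ?thesis .
qed (use prime_gt_0_nat[OF p] in simp)

lemma rat_padic_abs_unit:
  assumes p: "prime p" and "\<not> int p dvd b"
  shows "rat_padic_abs p (of_int b) = 1"
proof -
  have "b \<noteq> 0" using assms by auto
  then show ?thesis
    using rat_padic_abs_quotient[OF p, of b 1] not_dvd_imp_multiplicity_0[OF assms(2)] by simp
qed

text \<open>
  Dividing by the larger summand reduces the ultrametric inequality to \<open>1 + x\<close> with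
  \<open>rat_padic_abs p x \<le> 1\<close>, where \<open>x\<close> has a denominator prime to \<open>p\<close>.
\<close>

lemma rat_padic_abs_add_le:
  assumes p: "prime p"
  shows "rat_padic_abs p (q + r) \<le> max (rat_padic_abs p q) (rat_padic_abs p r)"
proof -
  have one: "rat_padic_abs p (1 + x) \<le> 1" if "rat_padic_abs p x \<le> 1" for x
  proof -
    obtain a b where ab: "x = of_int a / of_int b" "b \<noteq> 0" "\<not> int p dvd b"
      using rat_padic_abs_le_1_cases[OF p \<open>rat_padic_abs p x \<le> 1\<close>] .
    have "(1 + x) * of_int b = of_int (a + b)" using ab by (simp add: field_simps)
    then have "rat_padic_abs p (1 + x) = rat_padic_abs p (of_int (a + b))"
      using rat_padic_abs_mult[OF p, of "1 + x" "of_int b"] rat_padic_abs_unit[OF p ab(3)] by simp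
    also have "\<dots> \<le> 1" using rat_padic_abs_of_int_le_iff[OF p, of "a + b" 0] by simp
    finally show ?thesis .
  qed
  have le: "rat_padic_abs p (x + y) \<le> rat_padic_abs p x" if le: "rat_padic_abs p y \<le> rat_padic_abs p x" for x y
  proof (cases "x = 0")
    case True
    then have "\<not> 0 < rat_padic_abs p y" using le by simp
    then show ?thesis using True rat_padic_abs_pos[OF p, of y] by auto
  next
    case False
    then have pos: "0 < rat_padic_abs p x" by (rule rat_padic_abs_pos[OF p])
    have "rat_padic_abs p (y / x) * rat_padic_abs p x = rat_padic_abs p y"
      using False by (simp flip: rat_padic_abs_mult[OF p])
    then have "rat_padic_abs p (y / x) * rat_padic_abs p x \<le> 1 * rat_padic_abs p x"
      using le by simp
    then have "rat_padic_abs p (y / x) \<le> 1"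
      using pos by (rule mult_right_le_imp_le)
    then have "rat_padic_abs p x * rat_padic_abs p (1 + y / x) \<le> rat_padic_abs p x"
      using one[of "y / x"] pos by simp
    moreover have "x * (1 + y / x) = x + y" using False by (simp add: field_simps)
    ultimately show ?thesis by (simp flip: rat_padic_abs_mult[OF p])
  qed
  show ?thesis
    using le[of r q] le[of q r] by (cases "rat_padic_abs p r \<le> rat_padic_abs p q") (auto simp: add.commute)
qed

lemma rat_padic_abs_diff_le:
  "prime p \<Longrightarrow> rat_padic_abs p (q - r) \<le> max (rat_padic_abs p q) (rat_padic_abs p r)"
  using rat_padic_abs_add_le[of p q "- r"] by (simp add: rat_padic_abs_minus)

text \<open>
  The larger summand determines the absolute value: \<open>q\<close> is the difference of \<open>q + r\<close> and \<open>r\<close>.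
\<close>

lemma rat_padic_abs_add_eq:
  assumes p: "prime p" and less: "rat_padic_abs p r < rat_padic_abs p q"
  shows "rat_padic_abs p (q + r) = rat_padic_abs p q"
  using rat_padic_abs_add_le[OF p, of q r] rat_padic_abs_diff_le[OF p, of "q + r" r] less by simp

text \<open>
  Multiplying by \<open>p ^ n\<close> gives a fraction whose denominator is invertible modulo \<open>p ^ n\<close>, so that it
  is congruent to a natural number \<open>i < p ^ n\<close>.
\<close>

lemma rat_padic_approx:
  assumes p: "prime p" and q: "rat_padic_abs p q \<le> real p powi int n"
  shows "\<exists>i<p ^ n. rat_padic_abs p (q - of_nat i / of_nat (p ^ n)) \<le> 1"
proof -
  have p0: "0 < p" "(of_nat p :: rat) \<noteq> 0" using prime_gt_0_nat[OF p] by auto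
  define P :: int where "P = int p ^ n"
  have P: "0 < P" using p0 by (simp add: P_def)
  have absP: "rat_padic_abs p (of_int P) = real p powi (- int n)"
    using rat_padic_abs_quotient[OF p, of P 1] P p by (simp add: P_def)
  have inv: "real p powi int n * real p powi (- int n) = 1"
    using p0 by (simp add: power_int_minus)
  have "rat_padic_abs p (q * of_int P) \<le> real p powi int n * real p powi (- int n)"
    unfolding rat_padic_abs_mult[OF p] absP by (intro mult_right_mono q) simp
  then have "rat_padic_abs p (q * of_int P) \<le> 1" using inv by simp
  then obtain a b where ab: "q * of_int P = of_int a / of_int b" "b \<noteq> 0" "\<not> int p dvd b"
    using rat_padic_abs_le_1_cases[OF p] by blast
  have "coprime b P"
    using ab p unfolding P_def by (metis coprime_commute coprime_power_right_iff prime_imp_coprime prime_nat_int_transfer)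
  then obtain x y where xy: "x * b + y * P = 1"
    using bezout_int[of b P] by auto
  define i where "i = (a * x) mod P"
  have i: "0 \<le> i" "i < P" using P by (simp_all add: i_def)
  define t where "t = a * x div P"
  have i_eq: "i = a * x - P * t" by (simp add: i_def t_def minus_mult_div_eq_mod)
  have "a - i * b = a * (1 - x * b) + P * t * b"
    unfolding i_eq by (simp add: algebra_simps)
  also have "1 - x * b = y * P" using xy by simp
  finally have "a - i * b = P * (a * y + t * b)" by (simp add: algebra_simps)
  then have "P dvd a - i * b" by simp
  then have small: "rat_padic_abs p (of_int (a - i * b)) \<le> real p powi (- int n)"
    using rat_padic_abs_of_int_le_iff[OF p, of "a - i * b" n] by (simp only: P_def)
  have "(q - of_int i / of_int P) * of_int P * of_int b = of_int (a - i * b)"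
    using ab P by (simp add: field_simps)
  then have "rat_padic_abs p (q - of_int i / of_int P) * real p powi (- int n) = rat_padic_abs p (of_int (a - i * b))"
    using rat_padic_abs_mult[OF p] absP rat_padic_abs_unit[OF p ab(3)] by (metis mult.right_neutral)
  with small have "rat_padic_abs p (q - of_int i / of_int P) * real p powi (- int n) \<le> 1 * real p powi (- int n)"
    by simp
  moreover have "0 < real p powi (- int n)" using p0 by simp
  ultimately have "rat_padic_abs p (q - of_int i / of_int P) \<le> 1"
    by (rule mult_right_le_imp_le)
  moreover have "of_int i / of_int P = (of_nat (nat i) / of_nat (p ^ n) :: rat)"
    using i by (simp add: P_def)
  moreover have "nat i < p ^ n" using i by (simp add: P_def nat_less_iff)
  ultimately show ?thesis by metis
qed

section \<open>The p-adic numbers as cosets\<close>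

definition padic_class :: "nat \<Rightarrow> (nat \<Rightarrow> rat) \<Rightarrow> (nat \<Rightarrow> rat) set" where
  "padic_class p X = padic_null p +>\<^bsub>padic_Cauchy_ring p\<^esub> X"

definition padic_of_rat :: "nat \<Rightarrow> rat \<Rightarrow> (nat \<Rightarrow> rat) set" where
  "padic_of_rat p q = padic_class p (\<lambda>_. q)"

lemma padic_null_zero: "(\<lambda>_. 0) \<in> padic_null p"
  by (simp add: padic_null_def)

lemma padic_null_add:
  assumes p: "prime p" and "X \<in> padic_null p" "Y \<in> padic_null p"
  shows "(\<lambda>n. X n + Y n) \<in> padic_null p"
proof -
  have lim: "(\<lambda>n. rat_padic_abs p (X n) + rat_padic_abs p (Y n)) \<longlonglongrightarrow> 0"
    using tendsto_add[of "\<lambda>n. rat_padic_abs p (X n)" 0 sequentially "\<lambda>n. rat_padic_abs p (Y n)" 0] assms(2,3)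
    unfolding padic_null_def by simp
  have "rat_padic_abs p (X n + Y n) \<le> rat_padic_abs p (X n) + rat_padic_abs p (Y n)" for n
    using rat_padic_abs_add_le[OF p, of "X n" "Y n"] rat_padic_abs_nonneg[of p "X n"]
      rat_padic_abs_nonneg[of p "Y n"] by linarith
  then have "(\<lambda>n. rat_padic_abs p (X n + Y n)) \<longlonglongrightarrow> 0"
    by (intro Lim_null_comparison[OF _ lim]) simp
  then show ?thesis by (simp add: padic_null_def)
qed

lemma padic_null_minus: "prime p \<Longrightarrow> X \<in> padic_null p \<Longrightarrow> (\<lambda>n. - X n) \<in> padic_null p"
  by (simp add: padic_null_def rat_padic_abs_minus)

lemma padic_class_eq_image: "padic_class p X = (\<lambda>Z n. Z n + X n) ` padic_null p"
proof -
  have "add (padic_Cauchy_ring p) = (\<lambda>X Y n. X n + Y n)"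
    by (simp add: padic_Cauchy_ring_def)
  then show ?thesis
    unfolding padic_class_def a_r_coset_def' by (simp only: UNION_singleton_eq_range)
qed

text \<open>
  With this description sums and equality of cosets reduce to statements about representing
  sequences.
\<close>

lemma padic_class_iff: "Y \<in> padic_class p X \<longleftrightarrow> (\<lambda>n. Y n - X n) \<in> padic_null p"
proof
  assume "(\<lambda>n. Y n - X n) \<in> padic_null p"
  then have "(\<lambda>n. (Y n - X n) + X n) \<in> padic_class p X"
    unfolding padic_class_eq_image by (rule rev_image_eqI) simp
  then show "Y \<in> padic_class p X" by simp
qed (auto simp: padic_class_eq_image)

lemma padic_class_self: "X \<in> padic_class p X"
  by (simp add: padic_class_iff padic_null_zero)

lemma padic_class_eq_iff:
  assumes p: "prime p"
  shows "padic_class p X = padic_class p Y \<longleftrightarrow> (\<lambda>n. X n - Y n) \<in> padic_null p"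
proof
  assume "padic_class p X = padic_class p Y"
  then have "X \<in> padic_class p Y" using padic_class_self[of X p] by simp
  then show "(\<lambda>n. X n - Y n) \<in> padic_null p" by (simp add: padic_class_iff)
next
  assume XY: "(\<lambda>n. X n - Y n) \<in> padic_null p"
  show "padic_class p X = padic_class p Y"
  proof (intro equalityI subsetI)
    fix Z
    assume "Z \<in> padic_class p X"
    then show "Z \<in> padic_class p Y"
      using padic_null_add[OF p _ XY, of "\<lambda>n. Z n - X n"] by (simp add: padic_class_iff)
  next
    fix Z
    assume "Z \<in> padic_class p Y"
    then show "Z \<in> padic_class p X"
      using padic_null_add[OF p _ padic_null_minus[OF p XY], of "\<lambda>n. Z n - Y n"] by (simp add: padic_class_iff)
  qed
qed

lemma carrier_Qp: "carrier (Qp p) = padic_class p ` {X. padic_Cauchy p X}"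
proof -
  have "carrier (Qp p) = a_rcosets\<^bsub>padic_Cauchy_ring p\<^esub> padic_null p"
    by (simp add: Qp_def FactRing_def)
  moreover have "carrier (padic_Cauchy_ring p) = {X. padic_Cauchy p X}"
    by (simp add: padic_Cauchy_ring_def)
  ultimately show ?thesis
    unfolding A_RCOSETS_def' padic_class_def by blast
qed

lemma add_padic_class:
  assumes p: "prime p"
  shows "padic_class p X \<oplus>\<^bsub>Qp p\<^esub> padic_class p Y = padic_class p (\<lambda>n. X n + Y n)"
proof -
  have add_Qp: "add (Qp p) = set_add (padic_Cauchy_ring p)"
    by (simp add: Qp_def FactRing_def)
  have add_Cauchy: "add (padic_Cauchy_ring p) = (\<lambda>X Y n. X n + Y n)"
    by (simp add: padic_Cauchy_ring_def)
  have "padic_class p X \<oplus>\<^bsub>Qp p\<^esub> padic_class p Y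
      = {\<lambda>n. U n + V n | U V. U \<in> padic_class p X \<and> V \<in> padic_class p Y}"
    unfolding add_Qp set_add_def' add_Cauchy by blast
  also have "\<dots> = padic_class p (\<lambda>n. X n + Y n)"
  proof (intro equalityI subsetI)
    fix Z
    assume "Z \<in> {\<lambda>n. U n + V n | U V. U \<in> padic_class p X \<and> V \<in> padic_class p Y}"
    then obtain U V where UV: "Z = (\<lambda>n. U n + V n)" "U \<in> padic_class p X" "V \<in> padic_class p Y" by blast
    have "(\<lambda>n. (U n - X n) + (V n - Y n)) \<in> padic_null p"
      using UV by (intro padic_null_add[OF p]) (simp_all add: padic_class_iff)
    moreover have "(\<lambda>n. (U n - X n) + (V n - Y n)) = (\<lambda>n. Z n - (X n + Y n))"
      using UV by auto
    ultimately show "Z \<in> padic_class p (\<lambda>n. X n + Y n)"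
      by (simp only: padic_class_iff)
  next
    fix Z
    assume "Z \<in> padic_class p (\<lambda>n. X n + Y n)"
    moreover have "(\<lambda>n. Z n - (X n + Y n)) = (\<lambda>n. (Z n - Y n) - X n)" by auto
    ultimately have "(\<lambda>n. Z n - Y n) \<in> padic_class p X"
      by (simp only: padic_class_iff)
    then show "Z \<in> {\<lambda>n. U n + V n | U V. U \<in> padic_class p X \<and> V \<in> padic_class p Y}"
      using padic_class_self[of Y p]
      by (intro CollectI exI[of _ "\<lambda>n. Z n - Y n"] exI[of _ Y]) simp
  qed
  finally show ?thesis .
qed

lemma padic_Cauchy_const: "padic_Cauchy p (\<lambda>_. q)"
  by (simp add: padic_Cauchy_def)

lemma padic_Cauchy_add_const: "padic_Cauchy p X \<Longrightarrow> padic_Cauchy p (\<lambda>n. X n + q)"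
  by (simp add: padic_Cauchy_def)

lemma padic_of_rat_closed: "padic_of_rat p q \<in> carrier (Qp p)"
  by (auto simp: padic_of_rat_def carrier_Qp padic_Cauchy_const)

text \<open>
  The absolute value of a Cauchy sequence that is not null is eventually constant, because the
  differences of its members become smaller than the members.
\<close>

lemma padic_Cauchy_abs:
  assumes p: "prime p" and X: "padic_Cauchy p X"
  shows "X \<in> padic_null p \<or> (\<exists>N k. \<forall>m\<ge>N. rat_padic_abs p (X m) = real p powi k)"
proof (cases "X \<in> padic_null p")
  case False
  then obtain e where e: "0 < e" "\<And>N. \<exists>m\<ge>N. e \<le> rat_padic_abs p (X m)"
    by (auto simp: padic_null_def LIMSEQ_iff not_less)
  obtain N where N: "\<And>m n. N \<le> m \<Longrightarrow> N \<le> n \<Longrightarrow> rat_padic_abs p (X m - X n) < e"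
    using X e(1) unfolding padic_Cauchy_def by blast
  obtain n where n: "N \<le> n" "e \<le> rat_padic_abs p (X n)" using e(2) by blast
  then have "X n \<noteq> 0" using e(1) by auto
  then obtain k where k: "rat_padic_abs p (X n) = real p powi k" using rat_padic_abs_powi[OF p] by blast
  have "rat_padic_abs p (X m) = real p powi k" if "N \<le> m" for m
    using rat_padic_abs_add_eq[OF p, of "X m - X n" "X n"] N[OF that n(1)] n(2) k by simp
  then show ?thesis by blast
qed simp

lemma Qp_abs_padic_class:
  assumes p: "prime p" and lim: "(\<lambda>n. rat_padic_abs p (X n)) \<longlonglongrightarrow> c"
  shows "Qp_abs p (padic_class p X) = c"
proof -
  have "(\<lambda>n. rat_padic_abs p (Z n)) \<longlonglongrightarrow> c" if Z: "Z \<in> padic_class p X" for Z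
  proof -
    have null: "(\<lambda>n. rat_padic_abs p (Z n - X n)) \<longlonglongrightarrow> 0"
      using Z by (simp add: padic_class_iff padic_null_def)
    have "\<bar>rat_padic_abs p (Z n) - rat_padic_abs p (X n)\<bar> \<le> rat_padic_abs p (Z n - X n)" for n
    proof (cases "rat_padic_abs p (Z n - X n) < rat_padic_abs p (X n)")
      case True
      then show ?thesis using rat_padic_abs_add_eq[OF p True] by simp
    next
      case False
      then have "rat_padic_abs p (Z n) \<le> rat_padic_abs p (Z n - X n)"
        using rat_padic_abs_add_le[OF p, of "Z n - X n" "X n"] by simp
      then show ?thesis
        using False rat_padic_abs_nonneg[of p "Z n"] rat_padic_abs_nonneg[of p "X n"]
        unfolding abs_le_iff by linarith
    qed
    then have "(\<lambda>n. rat_padic_abs p (Z n) - rat_padic_abs p (X n)) \<longlonglongrightarrow> 0"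
      by (intro Lim_null_comparison[OF _ null]) auto
    from tendsto_add[OF this lim] show ?thesis by simp
  qed
  moreover have "c' = c" if "\<forall>Z\<in>padic_class p X. (\<lambda>n. rat_padic_abs p (Z n)) \<longlonglongrightarrow> c'" for c'
    using that padic_class_self[of X p] LIMSEQ_unique[OF _ lim] by blast
  ultimately show ?thesis unfolding Qp_abs_def by (intro the_equality) auto
qed

lemma Qp_abs_cases:
  assumes p: "prime p" and X: "padic_Cauchy p X"
  obtains (zero) "X \<in> padic_null p" "Qp_abs p (padic_class p X) = 0"
    | (powi) N k where "\<And>m. N \<le> m \<Longrightarrow> rat_padic_abs p (X m) = real p powi k" "Qp_abs p (padic_class p X) = real p powi k"
proof -
  consider "X \<in> padic_null p" | N k where "\<forall>m\<ge>N. rat_padic_abs p (X m) = real p powi k"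
    using padic_Cauchy_abs[OF p X] by blast
  then show thesis
  proof cases
    case 1
    then have "Qp_abs p (padic_class p X) = 0"
      by (intro Qp_abs_padic_class[OF p]) (simp add: padic_null_def)
    with 1 show ?thesis by (rule zero)
  next
    case (2 N k)
    have "(\<lambda>n. rat_padic_abs p (X n)) \<longlonglongrightarrow> real p powi k"
      using 2 by (intro tendsto_eventually) (auto simp: eventually_sequentially)
    then have "Qp_abs p (padic_class p X) = real p powi k" by (rule Qp_abs_padic_class[OF p])
    with 2 show ?thesis using powi by blast
  qed
qed

lemma Qp_abs_range:
  assumes "prime p" "x \<in> carrier (Qp p)"
  shows "Qp_abs p x = 0 \<or> (\<exists>k::int. Qp_abs p x = real p powi k)"
  using assms by (auto simp: carrier_Qp elim!: Qp_abs_cases[rotated])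

lemma padic_class_in_ball_iff:
  assumes p: "prime p" and X: "padic_Cauchy p X"
  shows "padic_class p X \<in> Qp_ball p (real p powi k) \<longleftrightarrow> (\<exists>N. \<forall>m\<ge>N. rat_padic_abs p (X m) \<le> real p powi k)"
proof -
  have mem: "padic_class p X \<in> Qp_ball p (real p powi k) \<longleftrightarrow> Qp_abs p (padic_class p X) \<le> real p powi k"
    using X by (auto simp: Qp_ball_def carrier_Qp)
  have pos: "0 < real p powi k" using prime_gt_0_nat[OF p] by simp
  from p X show ?thesis
  proof (cases rule: Qp_abs_cases)
    case zero
    then have "eventually (\<lambda>m. rat_padic_abs p (X m) < real p powi k) sequentially"
      using pos by (auto simp: padic_null_def intro: order_tendstoD)
    then have "\<exists>N. \<forall>m\<ge>N. rat_padic_abs p (X m) \<le> real p powi k"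
      by (auto simp: eventually_sequentially intro: less_imp_le)
    then show ?thesis using zero pos by (simp add: mem less_imp_le)
  next
    case (powi N l)
    have "real p powi l \<le> real p powi k" if "\<forall>m\<ge>N'. rat_padic_abs p (X m) \<le> real p powi k" for N'
      using that powi(1)[of "max N N'"] by (metis max.cobounded1 max.cobounded2)
    then show ?thesis using powi by (auto simp: mem intro!: exI[of _ N])
  qed
qed

text \<open>
  A ball of radius \<open>p ^ n\<close> is covered by \<open>p ^ n\<close> translates of the unit ball: a far enough member of
  a representing sequence is within distance \<open>1\<close> of the number, and \<open>rat_padic_approx\<close> applies to it.
\<close>

lemma Qp_ball_cover:
  assumes p: "prime p" and x: "x \<in> Qp_ball p (real p powi int n)"
  shows "\<exists>i<p ^ n. x \<in> (\<lambda>y. padic_of_rat p (of_nat i / of_nat (p ^ n)) \<oplus>\<^bsub>Qp p\<^esub> y) ` Qp_ball p 1"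
proof -
  obtain X where X: "x = padic_class p X" "padic_Cauchy p X"
    using x by (auto simp: Qp_ball_def carrier_Qp)
  obtain N where N: "\<And>m. N \<le> m \<Longrightarrow> rat_padic_abs p (X m) \<le> real p powi int n"
    using x X padic_class_in_ball_iff[OF p X(2)] by blast
  obtain N' where N': "\<And>m k. N' \<le> m \<Longrightarrow> N' \<le> k \<Longrightarrow> rat_padic_abs p (X m - X k) < 1"
    using X(2) unfolding padic_Cauchy_def by (meson zero_less_one)
  define K where "K = max N N'"
  obtain i where i: "i < p ^ n" "rat_padic_abs p (X K - of_nat i / of_nat (p ^ n)) \<le> 1"
    using rat_padic_approx[OF p N[of K]] by (auto simp: K_def)
  define c :: rat where "c = of_nat i / of_nat (p ^ n)"
  have "rat_padic_abs p (X m - c) \<le> 1" if "K \<le> m" for m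
    using rat_padic_abs_add_le[OF p, of "X m - X K" "X K - c"] i(2) N'[of m K] that
    by (simp add: K_def c_def)
  moreover have C: "padic_Cauchy p (\<lambda>m. X m - c)" using padic_Cauchy_add_const[OF X(2), of "- c"] by simp
  ultimately have "padic_class p (\<lambda>m. X m - c) \<in> Qp_ball p 1"
    using padic_class_in_ball_iff[OF p C, of 0] by auto
  moreover have "x = padic_of_rat p c \<oplus>\<^bsub>Qp p\<^esub> padic_class p (\<lambda>m. X m - c)"
    using X by (simp add: padic_of_rat_def add_padic_class[OF p])
  ultimately show ?thesis using i(1) unfolding c_def by blast
qed

lemma Qp_ball_translates:
  assumes p: "prime p" and y: "y \<in> Qp_ball p (real p powi (- int n))"
  shows "padic_of_rat p (of_nat i) \<oplus>\<^bsub>Qp p\<^esub> y \<in> Qp_ball p 1"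
proof -
  obtain Y where Y: "y = padic_class p Y" "padic_Cauchy p Y"
    using y by (auto simp: Qp_ball_def carrier_Qp)
  obtain N where N: "\<And>m. N \<le> m \<Longrightarrow> rat_padic_abs p (Y m) \<le> real p powi (- int n)"
    using y Y padic_class_in_ball_iff[OF p Y(2)] by blast
  have "real p powi (- int n) \<le> 1"
    using prime_gt_0_nat[OF p] by (simp add: power_int_minus inverse_le_1_iff)
  moreover have "rat_padic_abs p (of_nat i) \<le> 1"
    using rat_padic_abs_of_int_le_iff[OF p, of "int i" 0] by simp
  ultimately have "rat_padic_abs p (of_nat i + Y m) \<le> 1" if "N \<le> m" for m
    using rat_padic_abs_add_le[OF p, of "of_nat i" "Y m"] N[OF that] by simp
  moreover have C: "padic_Cauchy p (\<lambda>m. of_nat i + Y m)"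
    using padic_Cauchy_add_const[OF Y(2), of "of_nat i"] by (simp add: add.commute)
  ultimately show ?thesis
    using padic_class_in_ball_iff[OF p C, of 0] Y by (auto simp: padic_of_rat_def add_padic_class[OF p])
qed

text \<open>
  The translates by \<open>0, \<dots>, p ^ n - 1\<close> of a ball of radius \<open>p powi (- n)\<close> are disjoint, since two of
  these integers are congruent modulo \<open>p ^ n\<close> only if they are equal.
\<close>

lemma Qp_ball_translates_disjoint:
  assumes p: "prime p" and y: "y \<in> Qp_ball p (real p powi (- int n))" "y' \<in> Qp_ball p (real p powi (- int n))"
    and ij: "i < p ^ n" "j < p ^ n"
    and eq: "padic_of_rat p (of_nat i) \<oplus>\<^bsub>Qp p\<^esub> y = padic_of_rat p (of_nat j) \<oplus>\<^bsub>Qp p\<^esub> y'"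
  shows "i = j"
proof -
  obtain Y where Y: "y = padic_class p Y" "padic_Cauchy p Y"
    using y by (auto simp: Qp_ball_def carrier_Qp)
  obtain Y' where Y': "y' = padic_class p Y'" "padic_Cauchy p Y'"
    using y by (auto simp: Qp_ball_def carrier_Qp)
  obtain N where N: "\<And>m. N \<le> m \<Longrightarrow> rat_padic_abs p (Y m) \<le> real p powi (- int n)"
    using y Y padic_class_in_ball_iff[OF p Y(2)] by blast
  obtain N' where N': "\<And>m. N' \<le> m \<Longrightarrow> rat_padic_abs p (Y' m) \<le> real p powi (- int n)"
    using y Y' padic_class_in_ball_iff[OF p Y'(2)] by blast
  have "(\<lambda>m. (of_nat i + Y m) - (of_nat j + Y' m)) \<in> padic_null p"
    using eq Y Y' by (simp add: padic_of_rat_def add_padic_class[OF p] padic_class_eq_iff[OF p])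
  then have "eventually (\<lambda>m. rat_padic_abs p ((of_nat i + Y m) - (of_nat j + Y' m)) < real p powi (- int n)) sequentially"
    using prime_gt_0_nat[OF p] by (auto simp: padic_null_def intro: order_tendstoD)
  then obtain N'' where N'': "\<And>m. N'' \<le> m \<Longrightarrow> rat_padic_abs p ((of_nat i + Y m) - (of_nat j + Y' m)) < real p powi (- int n)"
    by (auto simp: eventually_sequentially)
  define m where "m = max N (max N' N'')"
  have m: "N \<le> m" "N' \<le> m" "N'' \<le> m" by (auto simp: m_def)
  have "rat_padic_abs p (Y m - Y' m) \<le> real p powi (- int n)"
    using rat_padic_abs_diff_le[OF p, of "Y m" "Y' m"] N[OF m(1)] N'[OF m(2)] by (simp only: max_def split: if_splits)
  moreover have "((of_nat i + Y m) - (of_nat j + Y' m)) - (Y m - Y' m) = of_int (int i - int j)"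
    by simp
  ultimately have "rat_padic_abs p (of_int (int i - int j)) \<le> real p powi (- int n)"
    using rat_padic_abs_diff_le[OF p, of "(of_nat i + Y m) - (of_nat j + Y' m)" "Y m - Y' m"] N''[OF m(3)]
    by (simp only: max_def split: if_splits)
  then have "int p ^ n dvd int i - int j"
    by (simp only: rat_padic_abs_of_int_le_iff[OF p])
  then have "int p ^ n dvd \<bar>int i - int j\<bar>" by simp
  moreover have "\<bar>int i - int j\<bar> < int p ^ n"
    using ij by (auto simp: abs_if simp flip: of_nat_power)
  ultimately have "\<not> 0 < \<bar>int i - int j\<bar>" using zdvd_not_zless by blast
  then show ?thesis by simp
qed

section \<open>Haar measure of subsets of balls\<close>

text \<open>
  For a radius \<open>p ^ n\<close> the ball is covered by \<open>p ^ n\<close> translates of the unit ball; for a radius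
  \<open>p powi (- n)\<close> the unit ball contains \<open>p ^ n\<close> disjoint translates of \<open>D\<close>. The measurability of the
  translates comes from their measure: a set that is not measurable would have measure \<open>0\<close>, so
  a translate of a set of positive measure is measurable.

  Measurability of the balls themselves is not derived from the topology. The function
  \<open>Qp_dist\<close> is unspecified outside the carrier, whereas the locale \<open>Metric_space\<close> asks for
  symmetry and nonnegativity on the whole type, so the facts of that locale say nothing about
  the topology defined by \<open>Qp_dist\<close>.
\<close>

lemma
  assumes p: "prime p" and M: "Qp_Haar p M"
  shows space_Haar: "space M = carrier (Qp p)"
    and sigma_finite_Haar: "sigma_finite_measure M"
    and emeasure_Haar_le: "\<And>D k. D \<in> sets M \<Longrightarrow> D \<subseteq> Qp_ball p (real p powi k) \<Longrightarrow> emeasure M D \<le> ennreal (real p powi k)"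
proof -
  obtain N where N: "sets N = sets (Qp_borel p)"
    and trans: "\<And>a A. a \<in> carrier (Qp p) \<Longrightarrow> A \<in> sets N \<Longrightarrow>
              emeasure N ((\<lambda>x. a \<oplus>\<^bsub>Qp p\<^esub> x) ` A) = emeasure N A"
    and unit: "emeasure N (Qp_ball p 1) = 1"
    and M_eq: "M = completion N"
    using M unfolding Qp_Haar_def by blast
  have "space N = space (Qp_borel p)" by (rule sets_eq_imp_space_eq[OF N])
  then have space_N: "space N = carrier (Qp p)" by (simp add: Qp_borel_def space_measure_of_conv)
  then show space_M: "space M = carrier (Qp p)" by (simp add: M_eq)
  have unit_sets: "Qp_ball p 1 \<in> sets N"
    using unit emeasure_notin_sets[of "Qp_ball p 1" N] by auto
  define T where "T n i = (\<lambda>y. padic_of_rat p (of_nat i / of_nat (p ^ n)) \<oplus>\<^bsub>Qp p\<^esub> y) ` Qp_ball p 1" for n i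
  have T: "emeasure N (T n i) = 1" for n i
    unfolding T_def using trans[OF padic_of_rat_closed unit_sets] unit by simp
  have T_sets: "T n i \<in> sets N" for n i
    using T[of n i] emeasure_notin_sets[of "T n i" N] by auto
  have cover: "Qp_ball p (real p powi int n) \<subseteq> (\<Union>i<p ^ n. T n i)" for n
    using Qp_ball_cover[OF p] unfolding T_def by blast
  have real_p: "1 < real p" using prime_gt_1_nat[OF p] by simp
  have le: "emeasure N D \<le> ennreal (real p powi k)" if D: "D \<in> sets N" "D \<subseteq> Qp_ball p (real p powi k)" for D k
  proof (cases "0 \<le> k")
    case True
    then obtain n where k: "k = int n" using nonneg_int_cases by blast
    have "emeasure N D \<le> emeasure N (\<Union>i<p ^ n. T n i)"
      using D cover[of n] T_sets by (intro emeasure_mono) (auto simp: k)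
    also have "\<dots> \<le> (\<Sum>i<p ^ n. emeasure N (T n i))"
      using T_sets by (intro emeasure_subadditive_finite) auto
    also have "\<dots> = ennreal (real p powi k)"
      by (simp add: T k ennreal_of_nat_eq_real_of_nat)
    finally show ?thesis .
  next
    case False
    then obtain n where k: "k = - int n" by (metis int_cases2 nle_le of_nat_0_le_iff)
    show ?thesis
    proof (cases "emeasure N D = 0")
      case nonnull: False
      define S where "S i = (\<lambda>y. padic_of_rat p (of_nat i) \<oplus>\<^bsub>Qp p\<^esub> y) ` D" for i
      have S: "emeasure N (S i) = emeasure N D" for i
        unfolding S_def by (rule trans[OF padic_of_rat_closed D(1)])
      have S_sets: "S i \<in> sets N" for i
        using S[of i] nonnull emeasure_notin_sets[of "S i" N] by auto
      have "disjoint_family_on S {..<p ^ n}"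
        using Qp_ball_translates_disjoint[OF p, of _ n] D(2)
        unfolding disjoint_family_on_def S_def k by (auto, blast)
      then have "(\<Sum>i<p ^ n. emeasure N (S i)) = emeasure N (\<Union>i<p ^ n. S i)"
        using S_sets by (intro sum_emeasure) auto
      also have "\<dots> \<le> emeasure N (Qp_ball p 1)"
        using Qp_ball_translates[OF p, of _ n] D(2) unit_sets
        by (intro emeasure_mono) (auto simp: S_def k)
      finally have sum_le: "ennreal (real (p ^ n)) * emeasure N D \<le> 1"
        by (simp add: S unit ennreal_of_nat_eq_real_of_nat)
      have inv: "real p powi k * real (p ^ n) = 1"
        using real_p by (simp add: k power_int_minus)
      have "emeasure N D = ennreal (real p powi k) * (ennreal (real (p ^ n)) * emeasure N D)"
        using inv real_p by (simp only: mult.assoc[symmetric] ennreal_mult[symmetric]) (simp add: ennreal_mult[symmetric])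
      also have "\<dots> \<le> ennreal (real p powi k) * 1"
        by (intro mult_left_mono sum_le) simp
      finally show ?thesis by simp
    qed simp
  qed
  show "emeasure M D \<le> ennreal (real p powi k)" if D: "D \<in> sets M" "D \<subseteq> Qp_ball p (real p powi k)" for D k
  proof -
    have "main_part N D \<union> null_part N D = D" using D(1) by (simp add: M_eq)
    then have "main_part N D \<subseteq> D" by blast
    then show ?thesis
      using D le[of "main_part N D" k] by (simp add: M_eq)
  qed
  show "sigma_finite_measure M"
  proof
    have "range (\<lambda>(n, i). T n i) \<subseteq> sets M" using T_sets by (auto simp: M_eq)
    moreover have "(\<Union>A\<in>range (\<lambda>(n, i). T n i). A) = space M"
    proof
      show "(\<Union>A\<in>range (\<lambda>(n, i). T n i). A) \<subseteq> space M"
        using T_sets[THEN sets.sets_into_space] by (auto simp: space_M space_N)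
      show "space M \<subseteq> (\<Union>A\<in>range (\<lambda>(n, i). T n i). A)"
      proof
        fix x assume x: "x \<in> space M"
        obtain n :: nat where "Qp_abs p x \<le> real p ^ n"
          using real_arch_pow[OF real_p, of "Qp_abs p x"] by (auto intro: less_imp_le)
        then have "x \<in> Qp_ball p (real p powi int n)" using x by (simp add: Qp_ball_def space_M)
        with cover[of n] have "\<exists>i. x \<in> T n i" by blast
        then show "x \<in> (\<Union>A\<in>range (\<lambda>(n, i). T n i). A)" by auto
      qed
    qed
    moreover have "emeasure M (T n i) = 1" for n i
      using T T_sets by (simp add: M_eq)
    ultimately show "\<exists>A. countable A \<and> A \<subseteq> sets M \<and> \<Union> A = space M \<and> (\<forall>a\<in>A. emeasure M a \<noteq> \<infinity>)"
      by (intro exI[of _ "range (\<lambda>(n, i). T n i)"]) auto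
  qed
qed

section \<open>The Hardy operator on Cesaro spaces\<close>

text \<open>
  If \<open>f\<close> is not integrable over the ball, the integral on the left is \<open>0\<close>.
\<close>

lemma norm_padic_Hardy_le:
  assumes "0 \<le> Qp_abs p x"
  shows "ennreal (norm (padic_Hardy p M f x))
      \<le> ennreal (1 / Qp_abs p x) * (\<integral>\<^sup>+y\<in>Qp_ball p (Qp_abs p x). ennreal (norm (f y)) \<partial>M)"
proof -
  let ?B = "Qp_ball p (Qp_abs p x)"
  have "ennreal (norm (LINT y:?B|M. f y)) \<le> (\<integral>\<^sup>+y\<in>?B. ennreal (norm (f y)) \<partial>M)"
  proof (cases "set_integrable M ?B f")
    case True
    then have "ennreal (norm (LINT y:?B|M. f y)) \<le> (\<integral>\<^sup>+y. ennreal (norm (indicator ?B y *\<^sub>R f y)) \<partial>M)"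
      unfolding set_integrable_def set_lebesgue_integral_def by (rule integral_norm_bound_ennreal)
    also have "\<dots> = (\<integral>\<^sup>+y\<in>?B. ennreal (norm (f y)) \<partial>M)"
      by (intro nn_integral_cong) (auto simp: indicator_def)
    finally show ?thesis .
  next
    case False
    then show ?thesis
      by (simp add: set_integrable_def set_lebesgue_integral_def not_integrable_integral_eq)
  qed
  then have "ennreal (1 / Qp_abs p x) * ennreal (norm (LINT y:?B|M. f y))
      \<le> ennreal (1 / Qp_abs p x) * (\<integral>\<^sup>+y\<in>?B. ennreal (norm (f y)) \<partial>M)"
    by (rule mult_left_mono) simp
  moreover have "norm (padic_Hardy p M f x) = 1 / Qp_abs p x * norm (LINT y:?B|M. f y)"
    unfolding padic_Hardy_def norm_mult norm_of_real using assms by simp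
  ultimately show ?thesis
    using assms by (simp only: ennreal_mult zero_le_divide_1_iff norm_ge_zero)
qed

theorem theorem5p1:
  fixes p :: nat and r :: real
    and M :: "(nat \<Rightarrow> rat) set measure"
    and f :: "(nat \<Rightarrow> rat) set \<Rightarrow> complex"
  assumes "prime p" and "1 < r"
    and "Qp_Haar p M"
    and "f \<in> Ces p M r"
  shows "Ces_norm p M r (padic_Hardy p M f)
           \<le> ennreal ((1 - 1 / real p) / (1 - real p powr (- (1 - 1 / r)))) * Ces_norm p M r f"
proof -
  note p = \<open>prime p\<close> and r = \<open>1 < r\<close> and M = \<open>Qp_Haar p M\<close>
  have q: "1 < real p" using prime_gt_1_nat[OF p] by simp
  have powi: "real p powi k = real p powr real_of_int k" for k
    using q by (simp add: powr_real_of_int')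
  define C where "C = (1 - 1 / real p) / (1 - real p powr (- (1 - 1 / r)))"
  have C: "0 < C"
    using q r by (simp add: C_def powr_less_one)
  define \<Phi> where "\<Phi> x = ennreal (1 / Qp_abs p x) * (\<integral>\<^sup>+y\<in>Qp_ball p (Qp_abs p x). ennreal (norm (f y)) \<partial>M)" for x
  have space: "space M = carrier (Qp p)" by (rule space_Haar[OF p M])
  have nonneg: "0 \<le> Qp_abs p x" if "x \<in> space M" for x
    using Qp_abs_range[OF p, of x] that by (auto simp: space)
  have ball: "y \<in> Qp_ball p c \<longleftrightarrow> Qp_abs p y \<le> c" if "y \<in> space M" for y c
    using that by (simp add: Qp_ball_def space)
  have "(\<integral>\<^sup>+x. ennreal_powr (ennreal (1 / Qp_abs p x) *
             (\<integral>\<^sup>+y\<in>Qp_ball p (Qp_abs p x). ennreal (norm (padic_Hardy p M f y)) \<partial>M)) r \<partial>M)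
      \<le> (\<integral>\<^sup>+x. ennreal_powr (ennreal (1 / Qp_abs p x) *
             (\<integral>\<^sup>+y. \<Phi> y * indicator {y. Qp_abs p y \<le> Qp_abs p x} y \<partial>M)) r \<partial>M)"
    unfolding \<Phi>_def using r
    by (intro nn_integral_mono ennreal_powr_mono mult_left_mono mult_mono norm_padic_Hardy_le nonneg)
       (auto simp: ball indicator_def)
  also have "\<dots> \<le> ennreal (C powr r) * (\<integral>\<^sup>+x. ennreal_powr (\<Phi> x) r \<partial>M)"
    unfolding C_def
  proof (rule Hardy_nn_integral[OF q r sigma_finite_Haar[OF p M]])
    show "Qp_abs p x = 0 \<or> (\<exists>k::int. Qp_abs p x = real p powr k)" if "x \<in> space M" for x
      using Qp_abs_range[OF p, of x] that by (simp add: space powi)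
    show "emeasure M D \<le> ennreal (real p powr k)"
      if D: "D \<in> sets M" "\<And>x. x \<in> D \<Longrightarrow> Qp_abs p x \<le> real p powr k" for D and k :: int
      using emeasure_Haar_le[OF p M D(1), of k] D(2) sets.sets_into_space[OF D(1)]
      by (auto simp: powi Qp_ball_def space)
  qed
  finally have "Ces_norm p M r (padic_Hardy p M f)
      \<le> ennreal_powr (ennreal (C powr r) * (\<integral>\<^sup>+x. ennreal_powr (\<Phi> x) r \<partial>M)) (1 / r)"
    unfolding Ces_norm_def using r by (intro ennreal_powr_mono) auto
  also have "\<dots> = ennreal C * Ces_norm p M r f"
    using C r by (simp add: ennreal_powr_cmult powr_powr Ces_norm_def \<Phi>_def)
  finally show ?thesis unfolding C_def .
qed

end
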